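(* Let $S$ be a conical cup with height $h$ and slant height $s$, and let $A\neq B$ be non-axial points on the side of $S$ (one or both may lie on the rim $T$). Position $S$ so that $A$ has cylindrical angle $0$ and $B$ has cylindrical angle $\theta$, where $\theta\in[0,\pi]$ is the angle between $\Gamma_A$ and $\Gamma_B$. For $t,u\in[0,\theta]$ let $\gamma_1$ be the classical minimal geodesic on the side from $A$ to $P_1[1,t,h]\in T$, let $\gamma_2$ be the classical minimal geodesic on the side from $P_2[1,\theta-u,h]\in T$ to $B$, and let $\gamma_3=\overline{P_1P_2}$ be the line segment on the lid. If the respective distances from $A$ and $B$ to the cone point are $a$ and $b$, then $$\ell(t,u)=\mathrm{length}(\gamma_1\cup\gamma_2\cup\gamma_3)=\sqrt{a^2-2as\cos(t/s)+s^2}+\sqrt{b^2-2bs\cos(u/s)+s^2}+\sqrt{2-2\cos(\theta-t-u)}.$$ Candidates for a minimizer are: (a) a classical minimal geodesic $\alpha$ from $A$ to $B$ on the side, or (b) a path $\beta=\gamma_1\cup\gamma_2\cup\gamma_3$ across the lid of minimal length $\ell(t_1,u_1)=\min_{(t,u)\in[0,\theta]^2}\ell(t,u)$. A path of smallest length in $\{\alpha,\beta\}$ is a minimal path on $S$ from $A$ to $B$.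
   Context: A conical cup with cone angle $\phi\in(0,\pi/2)$ and slant height $s=\csc\phi>1$ is the closed surface $S\subset\mathbb{R}^3$ which in cylindrical coordinates $[r,\vartheta,z]$ consists of the side $\{r=z\tan\phi,\ 0\le z\le h\}$ and the lid $\{r\le 1,\ z=h\}$, where $h=\cot\phi$ is the height; its rim $T$ is the boundary circle of the lid and its cone point is the origin. $P[r,\vartheta,z]$ denotes the point $P$ with these cylindrical coordinates. Axial points of $S$ are those on its axis of revolution $r=0$. For a non-axial point $P$, $\Gamma_P$ is the closed half-plane containing $P$ and bounded by the axis. A path on $S$ from $A$ to $B$ is a continuous map from a compact interval to $S$ starting at $A$ and ending at $B$; it is minimal if its length is at most that of every path on $S$ from $A$ to $B$. A classical minimal geodesic on the side is a shortest path among paths lying on the side. *)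

theory Defs
  imports "HOL-Analysis.Analysis"
begin

definition cyl :: "real \<Rightarrow> real \<Rightarrow> real \<Rightarrow> real ^ 3" where
  "cyl r \<theta> z = vector [r * cos \<theta>, r * sin \<theta>, z]"

definition has_cyl_angle :: "real ^ 3 \<Rightarrow> real \<Rightarrow> bool" where
  "has_cyl_angle P \<theta> \<longleftrightarrow> (\<exists>r\<ge>0. \<exists>z. P = cyl r \<theta> z)"

definition axial :: "real ^ 3 \<Rightarrow> bool" where
  "axial P \<longleftrightarrow> P $ 1 = 0 \<and> P $ 2 = 0"

definition cup_height :: "real \<Rightarrow> real" where
  "cup_height \<phi> = cot \<phi>"

definition cup_slant :: "real \<Rightarrow> real" where
  "cup_slant \<phi> = 1 / sin \<phi>"

text \<open>The cone point is the origin and the lid is the unit disc at height \<open>cup_height \<phi>\<close>.\<close>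

definition cup_side :: "real \<Rightarrow> (real ^ 3) set" where
  "cup_side \<phi> = {cyl (z * tan \<phi>) \<theta> z | \<theta> z. 0 \<le> z \<and> z \<le> cup_height \<phi>}"

definition cup_lid :: "real \<Rightarrow> (real ^ 3) set" where
  "cup_lid \<phi> = {cyl r \<theta> (cup_height \<phi>) | r \<theta>. 0 \<le> r \<and> r \<le> 1}"

definition cup :: "real \<Rightarrow> (real ^ 3) set" where
  "cup \<phi> = cup_side \<phi> \<union> cup_lid \<phi>"

definition rim_point :: "real \<Rightarrow> real \<Rightarrow> real ^ 3" where
  "rim_point \<phi> \<theta> = cyl 1 \<theta> (cup_height \<phi>)"

text \<open>Length is the supremum over partitions of the unit interval; it is \<open>\<infinity>\<close> for
  non-rectifiable paths.\<close>

definition curve_length :: "(real \<Rightarrow> 'a::metric_space) \<Rightarrow> ennreal" where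
  "curve_length g =
     (SUP (n, p) \<in> {(n, p :: nat \<Rightarrow> real). mono_on {..n} p \<and> p 0 = 0 \<and> p n = 1}.
        \<Sum>i<n. ennreal (dist (g (p i)) (g (p (Suc i)))))"

definition path_from_to :: "'a::metric_space set \<Rightarrow> 'a \<Rightarrow> 'a \<Rightarrow> (real \<Rightarrow> 'a) \<Rightarrow> bool" where
  "path_from_to X A B g \<longleftrightarrow>
     path g \<and> path_image g \<subseteq> X \<and> pathstart g = A \<and> pathfinish g = B"

text \<open>With \<open>X = cup \<phi>\<close> these are the minimal paths on the cup, with \<open>X = cup_side \<phi>\<close>
  the classical minimal geodesics on the side.\<close>

definition minimal_path :: "'a::metric_space set \<Rightarrow> 'a \<Rightarrow> 'a \<Rightarrow> (real \<Rightarrow> 'a) \<Rightarrow> bool" where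
  "minimal_path X A B g \<longleftrightarrow>
     path_from_to X A B g \<and> (\<forall>g'. path_from_to X A B g' \<longrightarrow> curve_length g \<le> curve_length g')"

text \<open>The classical minimal geodesics need not be unique (rim point at angle \<open>\<pi>\<close> from
  the endpoint), hence a predicate rather than a function.\<close>

definition lid_crossing ::
  "real \<Rightarrow> real \<Rightarrow> real ^ 3 \<Rightarrow> real ^ 3 \<Rightarrow> real \<Rightarrow> real \<Rightarrow> (real \<Rightarrow> real ^ 3) \<Rightarrow> bool" where
  "lid_crossing \<phi> \<theta> A B t u \<beta> \<longleftrightarrow>
     (\<exists>\<gamma>1 \<gamma>2. minimal_path (cup_side \<phi>) A (rim_point \<phi> t) \<gamma>1 \<and>
              minimal_path (cup_side \<phi>) (rim_point \<phi> (\<theta> - u)) B \<gamma>2 \<and>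
              \<beta> = \<gamma>1 +++ linepath (rim_point \<phi> t) (rim_point \<phi> (\<theta> - u)) +++ \<gamma>2)"

definition crossing_length :: "real \<Rightarrow> real \<Rightarrow> real \<Rightarrow> real \<Rightarrow> real \<Rightarrow> real \<Rightarrow> real" where
  "crossing_length s a b \<theta> t u =
     sqrt (a\<^sup>2 - 2 * a * s * cos (t / s) + s\<^sup>2) +
     sqrt (b\<^sup>2 - 2 * b * s * cos (u / s) + s\<^sup>2) +
     sqrt (2 - 2 * cos (\<theta> - t - u))"

end

(* The cone metric sqrt (a^2 + b^2 - 2 a b cos (k psi)), with k the sine of the cone angle and psi the
   angle between the half-planes of two points at slant distances a and b, satisfies the triangle
   inequality, dominates the Euclidean distance of R^3 and agrees with it to first order away from the
   cone point. Summing it along fine partitions therefore bounds the length of every path on the side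
   from below, and the straight segment in the unrolled cone attains the bound. A path that touches the
   lid is cut at its first and last point in the plane of the lid; folding the two rim points into the
   arc [0, theta] shortens all three pieces, so such a path is at least as long as some lid crossing. *)

theory Submission
  imports Defs
begin

text \<open>The obstacle is that a path on the side is merely continuous: it may wind around the
  axis or pass through the cone point, so unrolling it would need a continuous lift of its angle.
  The cone metric avoids the lift. It sees angles only through their cosine, so the angles at the
  points of a partition may be chosen independently, and winding is absorbed by
  \<open>circ_dist\<close>. Agreement to first order is used as a factor l < 1 per partition step.
  The factor is uniform because a path that misses the cone point keeps a positive distance m from
  it; l tends to 1 at the end. The upper bound rests on \<open>sin \<phi> < 1\<close>: half-planes
  at angle at most pi enclose an unrolled angle below pi, so the planar segment stays in the sector
  between its endpoints, where the cone metric is the metric of the plane. Between the two contacts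
  with the plane of the lid, the chord alone bounds whatever the path does, including excursions
  back to the side.\<close>

section \<open>Path length over parameter intervals\<close>

text \<open>The parameter bounds are free, so that a path can be cut at a parameter without
  reparametrising the pieces.\<close>

definition length_on :: "(real \<Rightarrow> 'a::metric_space) \<Rightarrow> real \<Rightarrow> real \<Rightarrow> ennreal" where
  "length_on g u v =
     (SUP (n, p) \<in> {(n, p :: nat \<Rightarrow> real). mono_on {..n} p \<and> p 0 = u \<and> p n = v}.
        \<Sum>i<n. ennreal (dist (g (p i)) (g (p (Suc i)))))"

lemma curve_length_eq_length_on: "curve_length g = length_on g 0 1"
  by (simp add: curve_length_def length_on_def)

lemma sum_le_length_on:
  assumes "mono_on {..n} p" "p 0 = u" "p n = v"
  shows "(\<Sum>i<n. ennreal (dist (g (p i)) (g (p (Suc i))))) \<le> length_on g u v"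
  unfolding length_on_def using assms
  by (intro SUP_upper2[where i = "(n, p)"]) auto

lemma length_on_leI:
  assumes "\<And>n p. mono_on {..n} p \<Longrightarrow> p 0 = u \<Longrightarrow> p n = v \<Longrightarrow>
    (\<Sum>i<n. ennreal (dist (g (p i)) (g (p (Suc i))))) \<le> L"
  shows "length_on g u v \<le> L"
  unfolding length_on_def using assms by (intro SUP_least) auto

lemma dist_le_length_on:
  assumes "u \<le> v"
  shows "ennreal (dist (g u) (g v)) \<le> length_on g u v"
  using sum_le_length_on[of 1 "\<lambda>i. if i = 0 then u else v" u v g] assms
  by (auto simp: mono_on_def)

lemma partition_bounds:
  fixes p :: "nat \<Rightarrow> real"
  assumes "mono_on {..n} p" "p 0 = u" "p n = v" "i \<le> n"
  shows "u \<le> p i" "p i \<le> v"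
  using mono_onD[OF assms(1), of 0 i] mono_onD[OF assms(1), of i n] assms by auto

text \<open>One inequality clamps a partition at c, the other concatenates two partitions.
  Additivity is what allows the pieces of a cut path to be bounded separately.\<close>

lemma length_on_split:
  fixes g :: "real \<Rightarrow> 'a::metric_space"
  assumes "u \<le> c" "c \<le> v"
  shows "length_on g u v = length_on g u c + length_on g c v"
proof (rule antisym)
  show "length_on g u v \<le> length_on g u c + length_on g c v"
  proof (rule length_on_leI)
    fix n and p :: "nat \<Rightarrow> real"
    assume p: "mono_on {..n} p" "p 0 = u" "p n = v"
    \<comment> \<open>Clamping keeps all n steps in both partitions, the surplus ones being
      degenerate; only a step that straddles c costs a triangle inequality.\<close>
    define q r where "q = (\<lambda>i. min (p i) c)" and "r = (\<lambda>i. max (p i) c)"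
    have q: "mono_on {..n} q" "q 0 = u" "q n = c" and r: "mono_on {..n} r" "r 0 = c" "r n = v"
      using p assms unfolding q_def r_def mono_on_def
      by (auto intro: min.coboundedI1 max.coboundedI1)
    have "ennreal (dist (g (p i)) (g (p (Suc i)))) \<le>
        ennreal (dist (g (q i)) (g (q (Suc i)))) + ennreal (dist (g (r i)) (g (r (Suc i))))"
      if "i < n" for i
    proof -
      have "p i \<le> p (Suc i)" using mono_onD[OF p(1), of i "Suc i"] that by simp
      then have "dist (g (p i)) (g (p (Suc i))) \<le>
          dist (g (q i)) (g (q (Suc i))) + dist (g (r i)) (g (r (Suc i)))"
        unfolding q_def r_def by (auto simp: min_def max_def dist_triangle)
      then show ?thesis by (simp add: ennreal_leI flip: ennreal_plus)
    qed
    then have "(\<Sum>i<n. ennreal (dist (g (p i)) (g (p (Suc i))))) \<le>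
        (\<Sum>i<n. ennreal (dist (g (q i)) (g (q (Suc i))))) +
        (\<Sum>i<n. ennreal (dist (g (r i)) (g (r (Suc i)))))"
      unfolding sum.distrib[symmetric] by (intro sum_mono) auto
    also have "\<dots> \<le> length_on g u c + length_on g c v"
      by (intro add_mono sum_le_length_on q r)
    finally show "(\<Sum>i<n. ennreal (dist (g (p i)) (g (p (Suc i))))) \<le>
        length_on g u c + length_on g c v" .
  qed
next
  have joined: "(\<Sum>i<n. ennreal (dist (g (p i)) (g (p (Suc i))))) +
      (\<Sum>i<m. ennreal (dist (g (q i)) (g (q (Suc i))))) \<le> length_on g u v"
    if p: "mono_on {..n} p" "p 0 = u" "p n = c" and q: "mono_on {..m} q" "q 0 = c" "q m = v"
    for n m p q
  proof -
    \<comment> \<open>\<open>p n\<close> and \<open>q 0\<close> are both c, so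
      \<open>r (n + i)\<close> equals \<open>q i\<close> already at i = 0.\<close>
    define r where "r = (\<lambda>i. if i \<le> n then p i else q (i - n))"
    have shift: "r (n + i) = q i" for i
      using p q by (auto simp: r_def)
    have "mono_on {..n + m} r"
    proof (rule mono_onI)
      fix i j assume ij: "i \<in> {..n + m}" "j \<in> {..n + m}" "i \<le> j"
      consider "j \<le> n" | "i \<le> n" "n < j" | "n < i" by linarith
      then show "r i \<le> r j"
      proof cases
        case 1
        then show ?thesis using ij mono_onD[OF p(1), of i j] by (simp add: r_def)
      next
        case 2
        then show ?thesis
          using ij partition_bounds(2)[OF p, of i] partition_bounds(1)[OF q, of "j - n"]
          by (force simp: r_def)
      next
        case 3
        then show ?thesis using ij mono_onD[OF q(1), of "i - n" "j - n"] by (simp add: r_def)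
      qed
    qed
    moreover have "r 0 = u" "r (n + m) = v"
      using p q shift by (simp_all add: r_def)
    ultimately have "(\<Sum>i<n + m. ennreal (dist (g (r i)) (g (r (Suc i))))) \<le> length_on g u v"
      by (rule sum_le_length_on)
    moreover have "(\<Sum>i<n + m. ennreal (dist (g (r i)) (g (r (Suc i))))) =
        (\<Sum>i<n. ennreal (dist (g (r i)) (g (r (Suc i))))) +
        (\<Sum>i<m. ennreal (dist (g (r (n + i))) (g (r (n + Suc i)))))"
      by (induction m) (simp_all add: add.assoc)
    moreover have "(\<Sum>i<n. ennreal (dist (g (r i)) (g (r (Suc i))))) =
        (\<Sum>i<n. ennreal (dist (g (p i)) (g (p (Suc i)))))"
      by (intro sum.cong) (auto simp: r_def)
    ultimately show ?thesis unfolding shift by simp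
  qed
  let ?P = "\<lambda>u v. {(n, p :: nat \<Rightarrow> real). mono_on {..n} p \<and> p 0 = u \<and> p n = v}"
  \<comment> \<open>Moving a summand into a supremum over \<open>ennreal\<close> requires a nonempty
    index set.\<close>
  have ne: "?P x y \<noteq> {}" if "x \<le> y" for x y :: real
  proof -
    have "(1, \<lambda>i. if i = 0 then x else y) \<in> ?P x y" using that by (auto simp: mono_on_def)
    then show ?thesis by blast
  qed
  have "(\<Sum>i<n. ennreal (dist (g (p i)) (g (p (Suc i))))) + length_on g c v \<le> length_on g u v"
    if p: "mono_on {..n} p" "p 0 = u" "p n = c" for n p
    unfolding length_on_def[of g c v] ennreal_SUP_add_right[OF ne[OF assms(2)]]
    by (intro SUP_least) (use joined[OF p] in force)
  then show "length_on g u c + length_on g c v \<le> length_on g u v"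
    unfolding length_on_def[of g u c] ennreal_SUP_add_left[OF ne[OF assms(1)], symmetric]
    by (intro SUP_least) force
qed

text \<open>Increasing affine maps carry partitions to partitions in both directions. The two
  functions have to match only on the interval, which suits the two branches of
  \<open>+++\<close>.\<close>

lemma length_on_affine:
  fixes g f :: "real \<Rightarrow> 'a::metric_space"
  assumes "0 < c" "\<And>x. u \<le> x \<Longrightarrow> x \<le> v \<Longrightarrow> g (c * x + d) = f x"
  shows "length_on g (c * u + d) (c * v + d) = length_on f u v"
proof (rule antisym)
  show "length_on g (c * u + d) (c * v + d) \<le> length_on f u v"
  proof (rule length_on_leI)
    fix n and p :: "nat \<Rightarrow> real"
    assume p: "mono_on {..n} p" "p 0 = c * u + d" "p n = c * v + d"
    define q where "q = (\<lambda>i. (p i - d) / c)"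
    have q: "mono_on {..n} q" "q 0 = u" "q n = v"
      using p assms(1) by (auto simp: q_def mono_on_def divide_right_mono)
    have "g (p i) = f (q i)" if "i \<le> n" for i
      using assms(2)[of "q i"] partition_bounds[OF q that] assms(1) by (simp add: q_def)
    then have "(\<Sum>i<n. ennreal (dist (g (p i)) (g (p (Suc i))))) =
        (\<Sum>i<n. ennreal (dist (f (q i)) (f (q (Suc i)))))"
      by (intro sum.cong) auto
    then show "(\<Sum>i<n. ennreal (dist (g (p i)) (g (p (Suc i))))) \<le> length_on f u v"
      using sum_le_length_on[OF q, of f] by simp
  qed
next
  show "length_on f u v \<le> length_on g (c * u + d) (c * v + d)"
  proof (rule length_on_leI)
    fix n and p :: "nat \<Rightarrow> real"
    assume p: "mono_on {..n} p" "p 0 = u" "p n = v"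
    define q where "q = (\<lambda>i. c * p i + d)"
    have q: "mono_on {..n} q" "q 0 = c * u + d" "q n = c * v + d"
      using p assms(1) by (auto simp: q_def mono_on_def)
    have "g (q i) = f (p i)" if "i \<le> n" for i
      using assms(2)[of "p i"] partition_bounds[OF p that] by (simp add: q_def)
    then have "(\<Sum>i<n. ennreal (dist (g (q i)) (g (q (Suc i))))) =
        (\<Sum>i<n. ennreal (dist (f (p i)) (f (p (Suc i)))))"
      by (intro sum.cong) auto
    then show "(\<Sum>i<n. ennreal (dist (f (p i)) (f (p (Suc i))))) \<le>
        length_on g (c * u + d) (c * v + d)"
      using sum_le_length_on[OF q, of g] by simp
  qed
qed

lemma curve_length_joinpaths:
  fixes g f :: "real \<Rightarrow> 'a::metric_space"
  assumes "pathfinish g = pathstart f"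
  shows "curve_length (g +++ f) = curve_length g + curve_length f"
proof -
  \<comment> \<open>The half intervals are written as images of 0 and 1 under affine maps so that
    \<open>length_on_affine\<close> unifies.\<close>
  have "length_on (g +++ f) (1/2 * 0 + 0) (1/2 * 1 + 0) = length_on g 0 1"
    by (rule length_on_affine) (auto simp: joinpaths_def)
  moreover have "length_on (g +++ f) (1/2 * 0 + 1/2) (1/2 * 1 + 1/2) = length_on f 0 1"
    using assms
    by (intro length_on_affine) (auto simp: joinpaths_def pathfinish_def pathstart_def algebra_simps)
  ultimately show ?thesis
    unfolding curve_length_eq_length_on using length_on_split[of 0 "1/2" 1 "g +++ f"] by simp
qed

lemma length_on_le_Lipschitz:
  fixes g :: "real \<Rightarrow> 'a::metric_space"
  assumes "0 \<le> L" "u \<le> v"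
    and "\<And>x y. u \<le> x \<Longrightarrow> x \<le> y \<Longrightarrow> y \<le> v \<Longrightarrow> dist (g x) (g y) \<le> L * (y - x)"
  shows "length_on g u v \<le> ennreal (L * (v - u))"
proof (rule length_on_leI)
  fix n and p :: "nat \<Rightarrow> real"
  assume p: "mono_on {..n} p" "p 0 = u" "p n = v"
  have "(\<Sum>i<n. dist (g (p i)) (g (p (Suc i)))) \<le> (\<Sum>i<n. L * (p (Suc i) - p i))"
  proof (intro sum_mono assms(3))
    fix i assume "i \<in> {..<n}"
    then show "u \<le> p i" "p i \<le> p (Suc i)" "p (Suc i) \<le> v"
      using partition_bounds[OF p] mono_onD[OF p(1), of i "Suc i"] by auto
  qed
  also have "\<dots> = L * (v - u)"
    using p sum_lessThan_telescope[of p n] by (simp flip: sum_distrib_left)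
  finally show "(\<Sum>i<n. ennreal (dist (g (p i)) (g (p (Suc i))))) \<le> ennreal (L * (v - u))"
    by (simp add: ennreal_leI)
qed

lemma curve_length_linepath:
  fixes P Q :: "'a::real_normed_vector"
  shows "curve_length (linepath P Q) = ennreal (dist P Q)"
proof (rule antisym)
  have "dist (linepath P Q x) (linepath P Q y) = \<bar>y - x\<bar> * dist P Q" for x y
  proof -
    have "linepath P Q x - linepath P Q y = (y - x) *\<^sub>R (P - Q)"
      by (simp add: linepath_def algebra_simps)
    then show ?thesis by (simp add: dist_norm)
  qed
  then show "curve_length (linepath P Q) \<le> ennreal (dist P Q)"
    unfolding curve_length_eq_length_on
    using length_on_le_Lipschitz[of "dist P Q" 0 1 "linepath P Q"] by (simp add: mult.commute)
  show "ennreal (dist P Q) \<le> curve_length (linepath P Q)"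
    unfolding curve_length_eq_length_on using dist_le_length_on[of 0 1 "linepath P Q"]
    by (simp add: linepath_def)
qed

section \<open>Angles modulo a full turn and the cone metric\<close>

text \<open>Distance from x to the nearest multiple of 2 pi, that is, the angle in [0, pi] between
  two half-planes whose cylindrical angles differ by x.\<close>

abbreviation circ_dist :: "real \<Rightarrow> real" where
  "circ_dist x \<equiv> arccos (cos x)"

lemma circ_dist_bounds: "0 \<le> circ_dist x" "circ_dist x \<le> pi"
  by (auto intro: arccos_lbound arccos_ubound)

lemma sin_circ_dist: "sin (circ_dist x) = \<bar>sin x\<bar>"
proof -
  have "sin (circ_dist x) = sqrt (1 - (cos x)\<^sup>2)"
    by (rule sin_arccos) auto
  then show ?thesis by (simp add: cos_squared_eq)
qed

text \<open>The triangle inequality on the circle in cosine form, which stays valid when the two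
  distances add up to more than pi. Both sides differ only in the sign of the product of the
  sines.\<close>

lemma cos_add_circ_dist: "cos (circ_dist x + circ_dist y) \<le> cos (x + y)"
  using abs_ge_self[of "sin x * sin y"] by (simp add: cos_add sin_circ_dist abs_mult)

text \<open>Folding the circle onto the half circle [0, pi] is a contraction.\<close>

lemma cos_diff_circ_dist: "cos (x - y) \<le> cos (circ_dist x - circ_dist y)"
  using abs_ge_self[of "sin x * sin y"] by (simp add: cos_diff sin_circ_dist abs_mult)

text \<open>The law of cosines in the unrolled cone, where angles about the axis shrink by the
  factor k; \<open>circ_dist\<close> selects the shorter way round.\<close>

definition cone_dist :: "real \<Rightarrow> real \<Rightarrow> real \<Rightarrow> real \<Rightarrow> real" where
  "cone_dist k a b \<psi> = sqrt (a\<^sup>2 + b\<^sup>2 - 2 * a * b * cos (k * circ_dist \<psi>))"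

lemma norm_polar_diff:
  fixes a b x y :: real
  shows "cmod (of_real a * cis x - of_real b * cis y) = sqrt (a\<^sup>2 + b\<^sup>2 - 2 * a * b * cos (x - y))"
proof -
  have "(a * cos x - b * cos y)\<^sup>2 + (a * sin x - b * sin y)\<^sup>2 =
      a\<^sup>2 * ((cos x)\<^sup>2 + (sin x)\<^sup>2) + b\<^sup>2 * ((cos y)\<^sup>2 + (sin y)\<^sup>2) - 2 * a * b * cos (x - y)"
    unfolding cos_diff by algebra
  then show ?thesis by (simp add: cmod_def)
qed

text \<open>Three points in the plane at polar angles 0, k x and k (x + y), with x and y already
  reduced by \<open>circ_dist\<close>, realise the two distances on the right. Their third side is
  at least the left-hand side, and the planar triangle inequality finishes.\<close>

lemma cone_dist_triangle:
  assumes "0 \<le> k" "k \<le> 1" "0 \<le> a" "0 \<le> b" "0 \<le> c"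
  shows "cone_dist k a c (x + y) \<le> cone_dist k a b x + cone_dist k b c y"
proof -
  let ?x = "circ_dist x" and ?y = "circ_dist y" and ?z = "circ_dist (x + y)"
  have b: "0 \<le> ?x" "?x \<le> pi" "0 \<le> ?y" "?y \<le> pi" "0 \<le> ?z" "?z \<le> pi"
    using circ_dist_bounds by auto
  have "cos (k * (?x + ?y)) \<le> cos (k * ?z)"
  proof (cases "?x + ?y \<le> pi")
    case True
    have "?z \<le> arccos (cos (?x + ?y))"
      by (rule arccos_le_arccos) (use cos_add_circ_dist[of x y] in auto)
    also have "\<dots> = ?x + ?y" using True b by (intro arccos_cos) auto
    finally have le: "k * ?z \<le> k * (?x + ?y)" using assms by (intro mult_left_mono)
    moreover have "k * (?x + ?y) \<le> 1 * pi" using True assms b by (intro mult_mono) auto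
    ultimately show ?thesis using b assms by (intro cos_monotone_0_pi_le) auto
  next
    case False
    \<comment> \<open>A sum beyond pi makes its complement w the candidate for the short way
      round.\<close>
    let ?w = "2 * pi - (?x + ?y)"
    have "?z \<le> arccos (cos ?w)"
      by (rule arccos_le_arccos) (use cos_add_circ_dist[of x y] in \<open>auto simp: cos_diff sin_double\<close>)
    also have "\<dots> = ?w" using False b by (intro arccos_cos) auto
    finally have z: "?z \<le> ?w" .
    show ?thesis
    proof (cases "k * (?x + ?y) \<le> pi")
      case True
      have "k * ?z \<le> k * (?x + ?y)" using assms False b by (intro mult_left_mono) auto
      then show ?thesis using True b assms by (intro cos_monotone_0_pi_le) auto
    next
      case gt: False
      \<comment> \<open>The scaled sum exceeds pi as well and has to be folded. Its complement to 2
        pi is at least k w because k is at most 1, so the cosines are again compared on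
        [0, pi].\<close>
      have "k * ?z \<le> k * ?w" using z assms by (intro mult_left_mono)
      also have "\<dots> \<le> 2 * pi - k * (?x + ?y)"
        using mult_right_mono[of k 1 "2 * pi"] assms by (simp add: algebra_simps)
      finally have "cos (2 * pi - k * (?x + ?y)) \<le> cos (k * ?z)"
        using gt b assms by (intro cos_monotone_0_pi_le) auto
      then show ?thesis by (simp add: cos_diff)
    qed
  qed
  then have "cone_dist k a c (x + y) \<le>
      cmod (of_real a * cis 0 - of_real c * cis (k * (?x + ?y)))"
    unfolding norm_polar_diff cone_dist_def using assms
    by (intro real_sqrt_le_mono) (simp add: mult_left_mono)
  also have "\<dots> \<le> cmod (of_real a * cis 0 - of_real b * cis (k * ?x)) +
      cmod (of_real b * cis (k * ?x) - of_real c * cis (k * (?x + ?y)))"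
    unfolding dist_norm[symmetric] by (rule dist_triangle)
  also have "\<dots> = cone_dist k a b x + cone_dist k b c y"
    unfolding norm_polar_diff cone_dist_def by (simp add: algebra_simps)
  finally show ?thesis .
qed

section \<open>Comparison of the cone metric with the distance of R^3\<close>

text \<open>A consequence of the concavity of the sine on [0, pi], obtained here from the sign of a
  derivative.\<close>

lemma mult_sin_le_sin_mult:
  fixes k x :: real
  assumes "0 \<le> k" "k \<le> 1" "0 \<le> x" "x \<le> pi"
  shows "k * sin x \<le> sin (k * x)"
proof -
  let ?f = "\<lambda>x. sin (k * x) - k * sin x"
  have "?f 0 \<le> ?f x"
  proof (rule DERIV_nonneg_imp_nondecreasing[OF assms(3)])
    fix y assume y: "0 \<le> y" "y \<le> x"
    have "k * y \<le> 1 * y" using y assms by (intro mult_right_mono) auto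
    then have "cos y \<le> cos (k * y)" using y assms by (intro cos_monotone_0_pi_le) auto
    moreover have "(?f has_real_derivative k * (cos (k * y) - cos y)) (at y)"
      by (auto intro!: derivative_eq_intros simp: algebra_simps)
    ultimately show "\<exists>d. (?f has_real_derivative d) (at y) \<and> 0 \<le> d"
      using assms(1) by (intro exI[of _ "k * (cos (k * y) - cos y)"]) simp
  qed
  then show ?thesis by simp
qed

text \<open>The inequality x \<le> tan x with its denominator cleared, hence meaningful up to
  pi.\<close>

lemma mult_cos_le_sin:
  fixes x :: real
  assumes "0 \<le> x" "x \<le> pi"
  shows "x * cos x \<le> sin x"
proof -
  let ?f = "\<lambda>x. sin x - x * cos x"
  have "?f 0 \<le> ?f x"
  proof (rule DERIV_nonneg_imp_nondecreasing[OF assms(1)])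
    fix y assume y: "0 \<le> y" "y \<le> x"
    have "(?f has_real_derivative y * sin y) (at y)"
      by (auto intro!: derivative_eq_intros simp: algebra_simps)
    then show "\<exists>d. (?f has_real_derivative d) (at y) \<and> 0 \<le> d"
      using y assms by (intro exI[of _ "y * sin y"]) (simp add: sin_ge_zero)
  qed
  then show ?thesis by simp
qed

lemma one_minus_cos: "1 - cos x = 2 * (sin (x / 2))\<^sup>2" for x :: real
  using cos_double_sin[of "x / 2"] by simp

text \<open>Coordinates of the unrolled cone: slant distance and angle, whereas
  \<open>cup_side\<close> is parametrised by height and angle.\<close>

definition cone_pt :: "real \<Rightarrow> real \<Rightarrow> real \<Rightarrow> real ^ 3" where
  "cone_pt \<phi> \<rho> \<alpha> = cyl (\<rho> * sin \<phi>) \<alpha> (\<rho> * cos \<phi>)"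

lemma norm_sq_3: "(norm (x :: real ^ 3))\<^sup>2 = (x $ 1)\<^sup>2 + (x $ 2)\<^sup>2 + (x $ 3)\<^sup>2"
  unfolding power2_norm_eq_inner inner_vec_def sum_3 by (simp add: power2_eq_square)

lemma cyl_nth [simp]: "cyl r x z $ 1 = r * cos x" "cyl r x z $ 2 = r * sin x" "cyl r x z $ 3 = z"
  by (simp_all add: cyl_def vector_3)

lemma dist_cyl_sq: "(dist (cyl r x z) (cyl r' y z'))\<^sup>2 =
    r\<^sup>2 + r'\<^sup>2 - 2 * r * r' * cos (x - y) + (z - z')\<^sup>2"
proof -
  have "(r * cos x - r' * cos y)\<^sup>2 + (r * sin x - r' * sin y)\<^sup>2 =
      r\<^sup>2 * ((cos x)\<^sup>2 + (sin x)\<^sup>2) + r'\<^sup>2 * ((cos y)\<^sup>2 + (sin y)\<^sup>2) - 2 * r * r' * cos (x - y)"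
    unfolding cos_diff by algebra
  then show ?thesis unfolding dist_norm norm_sq_3 by simp
qed

text \<open>Separating the radial part gives the same shape as in \<open>cone_dist_sq\<close>, so
  comparing the two distances comes down to comparing k^2 (1 - cos \<psi>) with 1 - cos (k
  \<psi>).\<close>

lemma dist_cone_pt_sq: "(dist (cone_pt \<phi> \<rho> \<alpha>) (cone_pt \<phi> \<rho>' \<beta>))\<^sup>2 =
    (\<rho> - \<rho>')\<^sup>2 + 2 * \<rho> * \<rho>' * ((sin \<phi>)\<^sup>2 * (1 - cos (\<alpha> - \<beta>)))"
proof -
  have "(dist (cone_pt \<phi> \<rho> \<alpha>) (cone_pt \<phi> \<rho>' \<beta>))\<^sup>2 =
      (\<rho> - \<rho>')\<^sup>2 * ((sin \<phi>)\<^sup>2 + (cos \<phi>)\<^sup>2) + 2 * \<rho> * \<rho>' * ((sin \<phi>)\<^sup>2 * (1 - cos (\<alpha> - \<beta>)))"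
    unfolding cone_pt_def dist_cyl_sq by algebra
  then show ?thesis by simp
qed

lemma cone_dist_sq:
  "(cone_dist k a b \<psi>)\<^sup>2 = (a - b)\<^sup>2 + 2 * a * b * (1 - cos (k * circ_dist \<psi>))"
proof -
  have "0 \<le> sqrt (a\<^sup>2 + b\<^sup>2 - 2 * a * b * cos (k * circ_dist \<psi> - 0))"
    unfolding norm_polar_diff[symmetric] by (rule norm_ge_zero)
  then have "0 \<le> a\<^sup>2 + b\<^sup>2 - 2 * a * b * cos (k * circ_dist \<psi>)"
    unfolding real_sqrt_ge_0_iff by simp
  then show ?thesis unfolding cone_dist_def by (simp add: power2_eq_square algebra_simps)
qed

lemma cone_dist_nonneg [simp]: "0 \<le> cone_dist k a b \<psi>"
proof -
  have "cone_dist k a b \<psi> = cmod (of_real a * cis (k * circ_dist \<psi>) - of_real b * cis 0)"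
    unfolding norm_polar_diff cone_dist_def by simp
  then show ?thesis by simp
qed

lemma norm_cone_pt: "norm (cone_pt \<phi> \<rho> \<alpha>) = \<bar>\<rho>\<bar>"
proof -
  have "(norm (cone_pt \<phi> \<rho> \<alpha>))\<^sup>2 =
      \<rho>\<^sup>2 * ((sin \<phi>)\<^sup>2 * ((cos \<alpha>)\<^sup>2 + (sin \<alpha>)\<^sup>2) + (cos \<phi>)\<^sup>2)"
    unfolding norm_sq_3 cone_pt_def cyl_nth by algebra
  also have "\<dots> = \<rho>\<^sup>2" by simp
  finally show ?thesis by (metis abs_norm_cancel power2_eq_iff_nonneg abs_ge_zero power2_abs)
qed

text \<open>After the radial terms cancel, what remains is the square of k sin (\<psi>/2) \<le> sin
  (k \<psi>/2).\<close>

lemma dist_cone_pt_le_cone_dist: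
  assumes "0 \<le> sin \<phi>" "0 \<le> a" "0 \<le> b"
  shows "dist (cone_pt \<phi> a \<alpha>) (cone_pt \<phi> b \<beta>) \<le> cone_dist (sin \<phi>) a b (\<alpha> - \<beta>)"
proof (rule power2_le_imp_le)
  let ?k = "sin \<phi>" and ?\<psi> = "circ_dist (\<alpha> - \<beta>)"
  have "?k * sin (?\<psi> / 2) \<le> sin (?k * (?\<psi> / 2))"
    using circ_dist_bounds[of "\<alpha> - \<beta>"] assms by (intro mult_sin_le_sin_mult) auto
  moreover have "0 \<le> sin (?\<psi> / 2)"
    using circ_dist_bounds[of "\<alpha> - \<beta>"] by (intro sin_ge_zero) auto
  then have "0 \<le> ?k * sin (?\<psi> / 2)" using assms by simp
  ultimately have "(?k * sin (?\<psi> / 2))\<^sup>2 \<le> (sin (?k * (?\<psi> / 2)))\<^sup>2" by (rule power_mono)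
  then have "?k\<^sup>2 * (1 - cos ?\<psi>) \<le> 1 - cos (?k * ?\<psi>)"
    unfolding one_minus_cos by (simp add: power_mult_distrib)
  then show "(dist (cone_pt \<phi> a \<alpha>) (cone_pt \<phi> b \<beta>))\<^sup>2 \<le> (cone_dist ?k a b (\<alpha> - \<beta>))\<^sup>2"
    unfolding dist_cone_pt_sq cone_dist_sq using assms
    by (intro add_left_mono mult_left_mono) auto
qed auto

text \<open>The angular part of E^2 is 4 a b k^2 sin^2 (\<psi>/2), which is at least 4 m^2 k^2 sin^2
  (\<psi>/2). Hence the factor on the left is at most w = cos^2 (\<psi>/2), and scaling by w already
  pushes the squared cone distance below E^2.\<close>

lemma cone_dist_local_le:
  fixes \<alpha> \<beta> :: real
  assumes "0 < sin \<phi>" "0 < m" "m \<le> a" "m \<le> b"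
  defines "E \<equiv> dist (cone_pt \<phi> a \<alpha>) (cone_pt \<phi> b \<beta>)"
  shows "(cone_dist (sin \<phi>) a b (\<alpha> - \<beta>))\<^sup>2 * (1 - E\<^sup>2 / (4 * (sin \<phi>)\<^sup>2 * m\<^sup>2)) \<le> E\<^sup>2"
proof -
  let ?k = "sin \<phi>" and ?\<psi> = "circ_dist (\<alpha> - \<beta>)" and ?D = "cone_dist (sin \<phi>) a b (\<alpha> - \<beta>)"
  define w where "w = (1 + cos ?\<psi>) / 2"
  have w: "w = (cos (?\<psi> / 2))\<^sup>2" "w \<le> 1"
    using cos_double_cos[of "?\<psi> / 2"] by (auto simp: w_def)
  then have "0 \<le> w" by simp
  have ab: "m\<^sup>2 \<le> a * b" unfolding power2_eq_square using assms by (intro mult_mono) auto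
  have bd: "0 \<le> ?\<psi>" "?\<psi> \<le> pi" using circ_dist_bounds by auto
  have E: "E\<^sup>2 = (a - b)\<^sup>2 + 2 * a * b * (?k\<^sup>2 * (1 - cos ?\<psi>))"
    unfolding E_def dist_cone_pt_sq by simp
  have "2 * m\<^sup>2 * (?k\<^sup>2 * (1 - cos ?\<psi>)) \<le> 2 * (a * b) * (?k\<^sup>2 * (1 - cos ?\<psi>))"
    using ab by (intro mult_right_mono) auto
  also have "\<dots> \<le> E\<^sup>2" unfolding E by (simp add: mult.assoc)
  finally have "(1 - cos ?\<psi>) / 2 \<le> E\<^sup>2 / (4 * ?k\<^sup>2 * m\<^sup>2)"
    using assms by (simp add: field_simps)
  then have "1 - E\<^sup>2 / (4 * ?k\<^sup>2 * m\<^sup>2) \<le> w" unfolding w_def by (simp add: field_simps)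
  then have "?D\<^sup>2 * (1 - E\<^sup>2 / (4 * ?k\<^sup>2 * m\<^sup>2)) \<le> ?D\<^sup>2 * w" by (rule mult_left_mono) simp
  also have "\<dots> = w * (a - b)\<^sup>2 + 2 * a * b * (w * (1 - cos (?k * ?\<psi>)))"
    unfolding cone_dist_sq by (simp add: algebra_simps)
  also have "\<dots> \<le> 1 * (a - b)\<^sup>2 + 2 * a * b * (?k\<^sup>2 * (1 - cos ?\<psi>))"
  proof (intro add_mono mult_left_mono mult_right_mono w \<open>0 \<le> w\<close>)
    \<comment> \<open>With the half angle h the chain is |sin (k h)| \<le> k h followed by h cos h
      \<le> sin h; the cosine is supplied by w.\<close>
    have "(sin (?k * ?\<psi> / 2))\<^sup>2 \<le> (?k * ?\<psi> / 2)\<^sup>2"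
      using abs_sin_x_le_abs_x[of "?k * ?\<psi> / 2"] by (metis abs_le_square_iff)
    then have "w * (1 - cos (?k * ?\<psi>)) \<le> w * (2 * (?k * ?\<psi> / 2)\<^sup>2)"
      unfolding one_minus_cos using \<open>0 \<le> w\<close> by (intro mult_left_mono) auto
    also have "\<dots> = 2 * ?k\<^sup>2 * (?\<psi> / 2 * cos (?\<psi> / 2))\<^sup>2"
      unfolding w by (simp add: power_mult_distrib power_divide algebra_simps)
    also have "\<dots> \<le> 2 * ?k\<^sup>2 * (sin (?\<psi> / 2))\<^sup>2"
      using bd by (intro mult_left_mono power_mono mult_cos_le_sin mult_nonneg_nonneg cos_ge_zero) auto
    also have "\<dots> = ?k\<^sup>2 * (1 - cos ?\<psi>)" unfolding one_minus_cos by simp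
    finally show "w * (1 - cos (?k * ?\<psi>)) \<le> ?k\<^sup>2 * (1 - cos ?\<psi>)" .
  qed (use assms in auto)
  finally show ?thesis using E by simp
qed

section \<open>Lower bound for the length of paths on the side\<close>

lemma cone_dist_chain:
  assumes "0 \<le> k" "k \<le> 1" "\<And>i. 0 \<le> \<rho> i"
  shows "cone_dist k (\<rho> 0) (\<rho> n) (\<alpha> 0 - \<alpha> n) \<le>
    (\<Sum>i<n. cone_dist k (\<rho> i) (\<rho> (Suc i)) (\<alpha> i - \<alpha> (Suc i)))"
proof (induction n)
  case 0
  show ?case by (simp add: cone_dist_def power2_eq_square)
next
  case (Suc n)
  have "cone_dist k (\<rho> 0) (\<rho> (Suc n)) ((\<alpha> 0 - \<alpha> n) + (\<alpha> n - \<alpha> (Suc n))) \<le>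
      cone_dist k (\<rho> 0) (\<rho> n) (\<alpha> 0 - \<alpha> n) +
      cone_dist k (\<rho> n) (\<rho> (Suc n)) (\<alpha> n - \<alpha> (Suc n))"
    using assms by (intro cone_dist_triangle)
  with Suc show ?case by simp
qed

lemma cone_dist_le_add:
  assumes "0 \<le> a" "0 \<le> b"
  shows "cone_dist k a b \<psi> \<le> a + b"
  unfolding cone_dist_def
proof (rule real_le_lsqrt)
  have "0 \<le> 2 * (a * b) * (1 + cos (k * circ_dist \<psi>))"
    using assms cos_ge_minus_one[of "k * circ_dist \<psi>"]
    by (intro mult_nonneg_nonneg) linarith+
  then show "a\<^sup>2 + b\<^sup>2 - 2 * a * b * cos (k * circ_dist \<psi>) \<le> (a + b)\<^sup>2"
    by (simp add: power2_eq_square algebra_simps)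
qed (use assms in auto)

text \<open>Stated through cosines so that angles outside [0, pi] can be compared without
  normalising them first.\<close>

lemma cone_dist_mono:
  assumes "0 \<le> k" "k \<le> 1" "0 \<le> a" "0 \<le> b" "cos y \<le> cos x"
  shows "cone_dist k a b x \<le> cone_dist k a b y"
proof -
  have "circ_dist x \<le> circ_dist y"
    using assms by (intro arccos_le_arccos) auto
  then have "k * circ_dist x \<le> k * circ_dist y"
    using assms by (intro mult_left_mono)
  moreover have "k * circ_dist y \<le> 1 * pi"
    using assms circ_dist_bounds by (intro mult_mono) auto
  ultimately have "cos (k * circ_dist y) \<le> cos (k * circ_dist x)"
    using assms circ_dist_bounds by (intro cos_monotone_0_pi_le) auto
  then show ?thesis
    unfolding cone_dist_def using assms by (intro real_sqrt_le_mono) (simp add: mult_left_mono)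
qed

text \<open>Away from the cone point, the intrinsic and the ambient distance of nearby points have ratio
  close to \<open>1\<close>, so the intrinsic distance can be summed along a fine partition; a path through
  the cone point has length at least \<open>a + b\<close>.\<close>

lemma cone_dist_le_length_on:
  fixes g :: "real \<Rightarrow> real ^ 3"
  assumes \<phi>: "0 < sin \<phi>" and uv: "u \<le> v" and cont: "continuous_on {u..v} g"
    and cone: "\<And>t. t \<in> {u..v} \<Longrightarrow> \<exists>\<rho> \<alpha>. 0 \<le> \<rho> \<and> g t = cone_pt \<phi> \<rho> \<alpha>"
    and gu: "g u = cone_pt \<phi> a \<alpha>" and gv: "g v = cone_pt \<phi> b \<beta>" and ab: "0 \<le> a" "0 \<le> b"
  shows "ennreal (cone_dist (sin \<phi>) a b (\<alpha> - \<beta>)) \<le> length_on g u v"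
proof (cases "\<exists>t\<in>{u..v}. g t = 0")
  case True
  then obtain c where c: "u \<le> c" "c \<le> v" "g c = 0" by auto
  have "ennreal (cone_dist (sin \<phi>) a b (\<alpha> - \<beta>)) \<le> ennreal (a + b)"
    by (intro ennreal_leI cone_dist_le_add ab)
  also have "\<dots> = ennreal (dist (g u) (g c)) + ennreal (dist (g c) (g v))"
    using c ab by (simp add: gu gv norm_cone_pt)
  also have "\<dots> \<le> length_on g u v"
    unfolding length_on_split[OF c(1,2)] by (intro add_mono dist_le_length_on c)
  finally show ?thesis .
next
  case False
  let ?k = "sin \<phi>" and ?L = "length_on g u v"
  define \<rho> where "\<rho> t = norm (g t)" for t
  have "\<exists>\<alpha>. g t = cone_pt \<phi> (\<rho> t) \<alpha>" if "t \<in> {u..v}" for t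
    using cone[OF that] by (auto simp: \<rho>_def norm_cone_pt)
  \<comment> \<open>\<open>ang\<close> is chosen separately at each parameter and may jump;
    \<open>cone_dist_chain\<close> holds for arbitrary angles.\<close>
  then obtain ang where ang: "\<And>t. t \<in> {u..v} \<Longrightarrow> g t = cone_pt \<phi> (\<rho> t) (ang t)" by metis
  have "continuous_on {u..v} \<rho>" unfolding \<rho>_def by (intro continuous_on_norm cont)
  then obtain c where c: "c \<in> {u..v}" "\<And>t. t \<in> {u..v} \<Longrightarrow> \<rho> c \<le> \<rho> t"
    using continuous_attains_inf[of "{u..v}" \<rho>] uv by auto
  define m where "m = \<rho> c"
  have m: "0 < m" "\<And>t. t \<in> {u..v} \<Longrightarrow> m \<le> \<rho> t"
    using False c unfolding m_def by (auto simp: \<rho>_def)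
  have ends: "\<rho> u = a" "\<rho> v = b"
    using ab by (auto simp: \<rho>_def gu gv norm_cone_pt)
  \<comment> \<open>The chosen angles at u and v agree with \<alpha> and \<beta> only modulo 2 pi, a
    difference that \<open>cone_dist\<close> does not see.\<close>
  have trig: "cos x = cos y \<and> sin x = sin y"
    if "cone_pt \<phi> r x = cone_pt \<phi> r y" "0 < r" for r x y
  proof -
    have "cone_pt \<phi> r x $ 1 = cone_pt \<phi> r y $ 1" "cone_pt \<phi> r x $ 2 = cone_pt \<phi> r y $ 2"
      using that by auto
    then show ?thesis using that(2) \<phi> by (simp add: cone_pt_def)
  qed
  have "0 < a" "0 < b" using m(2)[of u] m(2)[of v] m(1) uv ends by auto
  then have "cos (ang u) = cos \<alpha> \<and> sin (ang u) = sin \<alpha>" "cos (ang v) = cos \<beta> \<and> sin (ang v) = sin \<beta>"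
    using trig[of a "ang u" \<alpha>] trig[of b "ang v" \<beta>] ang[of u] ang[of v] ends uv gu gv by auto
  then have D: "cone_dist ?k a b (\<alpha> - \<beta>) = cone_dist ?k (\<rho> u) (\<rho> v) (ang u - ang v)"
    by (simp add: cone_dist_def cos_diff ends)
  \<comment> \<open>A loss factor l below 1 leaves room for the first-order error of each step;
    \<open>field_le_mult_one_interval\<close> removes it at the end.\<close>
  have scaled: "ennreal (l * cone_dist ?k (\<rho> u) (\<rho> v) (ang u - ang v)) \<le> ?L"
    if l: "0 < l" "l < 1" for l
  proof -
    \<comment> \<open>The solution of 1 - e^2 / (4 k^2 m^2) = l^2: below the ambient distance e,
      \<open>cone_dist_local_le\<close> loses at most the factor l.\<close>
    define e where "e = 2 * ?k * m * sqrt (1 - l\<^sup>2)"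
    have l2: "l\<^sup>2 < 1" using l by (simp add: power_less_one_iff)
    have e: "0 < e" "e\<^sup>2 = 4 * ?k\<^sup>2 * m\<^sup>2 * (1 - l\<^sup>2)"
      using l2 m \<phi> by (auto simp: e_def power_mult_distrib)
    have step: "l * cone_dist ?k (\<rho> x) (\<rho> y) (ang x - ang y) \<le> dist (g x) (g y)"
      if xy: "x \<in> {u..v}" "y \<in> {u..v}" "dist (g x) (g y) < e" for x y
    proof (rule power2_le_imp_le)
      let ?D = "cone_dist ?k (\<rho> x) (\<rho> y) (ang x - ang y)" and ?E = "dist (g x) (g y)"
      have "?E\<^sup>2 \<le> e\<^sup>2" using xy by (intro power_mono) auto
      then have "l\<^sup>2 \<le> 1 - ?E\<^sup>2 / (4 * ?k\<^sup>2 * m\<^sup>2)"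
        unfolding e using m \<phi> by (simp add: field_simps)
      then have "?D\<^sup>2 * l\<^sup>2 \<le> ?D\<^sup>2 * (1 - ?E\<^sup>2 / (4 * ?k\<^sup>2 * m\<^sup>2))"
        by (rule mult_left_mono) simp
      also have "\<dots> \<le> ?E\<^sup>2"
        unfolding ang[OF xy(1)] ang[OF xy(2)]
        using cone_dist_local_le[OF \<phi> m(1) m(2)[OF xy(1)] m(2)[OF xy(2)]] .
      finally show "(l * ?D)\<^sup>2 \<le> ?E\<^sup>2" by (simp add: power_mult_distrib mult.commute)
    qed simp
    obtain d where d: "0 < d"
      "\<And>x y. x \<in> {u..v} \<Longrightarrow> y \<in> {u..v} \<Longrightarrow> dist y x < d \<Longrightarrow> dist (g y) (g x) < e"
      using compact_uniformly_continuous[OF cont compact_Icc] e(1)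
      unfolding uniformly_continuous_on_def by blast
    obtain n :: nat where n: "(v - u) / d < n" using reals_Archimedean2 by blast
    have "0 \<le> (v - u) / d" using uv d by simp
    then have n0: "0 < n" using n by (cases n) auto
    define p where "p = (\<lambda>i. u + (v - u) * (real i / real n))"
    have p: "mono_on {..n} p" "p 0 = u" "p n = v"
      using uv n0 by (auto simp: p_def mono_on_def intro!: mult_left_mono divide_right_mono)
    have pin: "p i \<in> {u..v}" if "i \<le> n" for i using partition_bounds[OF p that] by simp
    have small: "l * cone_dist ?k (\<rho> (p i)) (\<rho> (p (Suc i))) (ang (p i) - ang (p (Suc i))) \<le>
        dist (g (p i)) (g (p (Suc i)))" if "i < n" for i
    proof (rule step)
      have "p (Suc i) - p i = (v - u) / n" using n0 by (simp add: p_def field_simps)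
      also have "\<dots> < d" using n d n0 by (simp add: field_simps)
      finally have "dist (p i) (p (Suc i)) < d"
        using mono_onD[OF p(1), of i "Suc i"] that by (simp add: dist_real_def)
      then show "dist (g (p i)) (g (p (Suc i))) < e" using that by (intro d pin) auto
    qed (use that pin in auto)
    have "l * cone_dist ?k (\<rho> u) (\<rho> v) (ang u - ang v) \<le>
        l * (\<Sum>i<n. cone_dist ?k (\<rho> (p i)) (\<rho> (p (Suc i))) (ang (p i) - ang (p (Suc i))))"
      using cone_dist_chain[of ?k "\<lambda>i. \<rho> (p i)" n "\<lambda>i. ang (p i)"] p \<phi> l
      by (intro mult_left_mono) (auto simp: \<rho>_def)
    also have "\<dots> \<le> (\<Sum>i<n. dist (g (p i)) (g (p (Suc i))))"
      unfolding sum_distrib_left using small by (intro sum_mono) auto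
    finally have "ennreal (l * cone_dist ?k (\<rho> u) (\<rho> v) (ang u - ang v)) \<le>
        (\<Sum>i<n. ennreal (dist (g (p i)) (g (p (Suc i)))))"
      by (simp add: ennreal_leI)
    also have "\<dots> \<le> ?L" by (rule sum_le_length_on[OF p])
    finally show ?thesis .
  qed
  show ?thesis
  proof (cases ?L)
    case (real r)
    have "cone_dist ?k (\<rho> u) (\<rho> v) (ang u - ang v) \<le> r"
    proof (rule field_le_mult_one_interval)
      fix l :: real assume "0 < l" "l < 1"
      then show "l * cone_dist ?k (\<rho> u) (\<rho> v) (ang u - ang v) \<le> r"
        using scaled[of l] real by simp
    qed
    then show ?thesis unfolding D real(2) by (rule ennreal_leI)
  qed simp
qed

section \<open>The unrolled segment and minimal paths on the side\<close>

text \<open>The segment lies above the real axis and, after rotation by -\<omega>, below it. It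
  therefore stays in the sector between its endpoints.\<close>

lemma Arg_segment_bounds:
  fixes a b t \<omega> :: real
  assumes "0 < a" "0 < b" "0 \<le> \<omega>" "\<omega> < pi" "0 \<le> t" "t \<le> 1"
  defines "w \<equiv> complex_of_real ((1 - t) * a) + of_real (t * b) * cis \<omega>"
  shows "0 \<le> Arg w" "Arg w \<le> \<omega>"
proof -
  let ?x = "Arg w"
  have w: "w = rcis (cmod w) ?x" by (simp add: rcis_cmod_Arg)
  have Im: "Im w = t * b * sin \<omega>" by (simp add: w_def)
  have s\<omega>: "0 \<le> sin \<omega>" using assms by (intro sin_ge_zero) auto
  show x0: "0 \<le> ?x"
    unfolding Arg_less_0 Im using s\<omega> assms by simp
  show "?x \<le> \<omega>"
  proof (rule ccontr)
    assume gt: "\<not> ?x \<le> \<omega>"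
    have "cmod w * sin (?x - \<omega>) = Im (w * cis (- \<omega>))"
      by (subst w) (simp add: sin_diff algebra_simps)
    also have "\<dots> = - ((1 - t) * a * sin \<omega>)"
      by (simp add: w_def algebra_simps)
    also have "\<dots> \<le> 0" using s\<omega> assms by simp
    finally have le: "cmod w * sin (?x - \<omega>) \<le> 0" .
    have "?x \<noteq> 0" using gt x0 assms by auto
    then have "w \<noteq> 0" by (auto simp: Arg_zero)
    then have "sin (?x - \<omega>) \<le> 0" using le by (simp add: mult_le_0_iff)
    moreover have "?x \<le> pi" by (rule Arg_le_pi)
    \<comment> \<open>A positive angle of at most pi with nonpositive sine is pi itself, which
      leaves only \<omega> = 0; but then w lies on the nonnegative real axis.\<close>
    ultimately have "?x = pi" "\<omega> = 0"
      using sin_gt_zero[of "?x - \<omega>"] gt assms by linarith+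
    then have "w = of_real ((1 - t) * a + t * b)" by (simp add: w_def)
    moreover have "0 \<le> (1 - t) * a + t * b" using assms by simp
    ultimately have "?x = 0" by (metis Arg_of_real norm_of_real not_le)
    then show False using \<open>?x = pi\<close> by simp
  qed
qed

lemma cup_side_eq:
  assumes "0 < \<phi>" "\<phi> < pi / 2"
  shows "cup_side \<phi> = {cone_pt \<phi> \<rho> \<alpha> | \<rho> \<alpha>. 0 \<le> \<rho> \<and> \<rho> \<le> cup_slant \<phi>}"
proof -
  have sc: "0 < sin \<phi>" "0 < cos \<phi>"
    using assms by (auto intro: sin_gt_zero cos_gt_zero)
  show ?thesis
  proof (intro equalityI subsetI)
    fix x assume "x \<in> cup_side \<phi>"
    then obtain \<alpha> z where "x = cyl (z * tan \<phi>) \<alpha> z" "0 \<le> z" "z \<le> cup_height \<phi>"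
      by (auto simp: cup_side_def)
    then have "x = cone_pt \<phi> (z / cos \<phi>) \<alpha> \<and> 0 \<le> z / cos \<phi> \<and> z / cos \<phi> \<le> cup_slant \<phi>"
      using sc by (auto simp: cone_pt_def tan_def cup_height_def cup_slant_def cot_def field_simps)
    then show "x \<in> {cone_pt \<phi> \<rho> \<alpha> | \<rho> \<alpha>. 0 \<le> \<rho> \<and> \<rho> \<le> cup_slant \<phi>}" by blast
  next
    fix x assume "x \<in> {cone_pt \<phi> \<rho> \<alpha> | \<rho> \<alpha>. 0 \<le> \<rho> \<and> \<rho> \<le> cup_slant \<phi>}"
    then obtain \<rho> \<alpha> where x: "x = cone_pt \<phi> \<rho> \<alpha>" "0 \<le> \<rho>" "\<rho> \<le> cup_slant \<phi>" by auto
    have "x = cyl (\<rho> * cos \<phi> * tan \<phi>) \<alpha> (\<rho> * cos \<phi>)"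
      using sc by (simp add: x(1) cone_pt_def tan_def)
    moreover have "0 \<le> \<rho> * cos \<phi>" using x(2) sc by simp
    moreover have "\<rho> * cos \<phi> \<le> cup_height \<phi>"
      using mult_right_mono[OF x(3), of "cos \<phi>"] sc
      by (simp add: cup_height_def cup_slant_def cot_def)
    ultimately show "x \<in> cup_side \<phi>"
      unfolding cup_side_def by blast
  qed
qed

text \<open>The planar segment w is rolled back onto the cone by keeping the modulus and dividing
  the argument by k. Rolling does not increase distances, so the path inherits the Lipschitz
  constant L of the segment.\<close>

lemma ex_cone_path:
  assumes \<phi>: "0 < \<phi>" "\<phi> < pi / 2" and a: "0 < a" "a \<le> cup_slant \<phi>"
    and b: "0 < b" "b \<le> cup_slant \<phi>" and \<psi>: "0 \<le> \<psi>" "\<psi> \<le> pi"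
  shows "\<exists>g. path_from_to (cup_side \<phi>) (cone_pt \<phi> a \<alpha>) (cone_pt \<phi> b (\<alpha> + \<psi>)) g \<and>
    curve_length g \<le> ennreal (cone_dist (sin \<phi>) a b \<psi>)"
proof -
  define k where "k = sin \<phi>"
  have "sin \<phi> < sin (pi / 2)" using \<phi> by (intro sin_monotone_2pi) auto
  then have k: "0 < k" "k < 1" using \<phi> by (auto simp: k_def sin_gt_zero)
  define \<omega> where "\<omega> = k * \<psi>"
  have "k * \<psi> \<le> k * pi" using k \<psi> by (intro mult_left_mono) auto
  also have "\<dots> < 1 * pi" using k by (intro mult_strict_right_mono) auto
  finally have \<omega>: "0 \<le> \<omega>" "\<omega> < pi" using k \<psi> by (auto simp: \<omega>_def)
  define w where "w t = complex_of_real ((1 - t) * a) + of_real (t * b) * cis \<omega>" for t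
  define g where "g t = cone_pt \<phi> (cmod (w t)) (\<alpha> + Arg (w t) / k)" for t
  define L where "L = cone_dist k a b \<psi>"
  have Arg: "0 \<le> Arg (w t) \<and> Arg (w t) \<le> \<omega>" if "t \<in> {0..1}" for t
    using Arg_segment_bounds[OF a(1) b(1) \<omega>, of t] that by (simp add: w_def)
  have L: "L = cmod (of_real a * cis \<omega> - of_real b * cis 0)" "L = cmod (of_real a * cis 0 - of_real b * cis \<omega>)"
    unfolding norm_polar_diff L_def cone_dist_def using \<psi> by (simp_all add: arccos_cos \<omega>_def)
  have lip: "dist (g x) (g y) \<le> L * \<bar>x - y\<bar>" if "x \<in> {0..1}" "y \<in> {0..1}" for x y
  proof -
    let ?d = "Arg (w x) - Arg (w y)"
    have "\<bar>?d\<bar> \<le> \<omega>" using Arg[OF that(1)] Arg[OF that(2)] by auto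
    \<comment> \<open>Inside the sector the angle difference stays at most pi, so
      \<open>circ_dist\<close> is its absolute value and the cone distance is the planar
      one.\<close>
    then have "\<bar>?d / k\<bar> \<le> \<psi>" using k by (simp add: \<omega>_def field_simps)
    then have "\<bar>?d / k\<bar> \<le> pi" using \<psi> by linarith
    then have "circ_dist (?d / k) = \<bar>?d / k\<bar>" by (rule arccos_cos_eq_abs)
    then have kd: "k * circ_dist (?d / k) = \<bar>?d\<bar>" using k by simp
    have "dist (g x) (g y) \<le> cone_dist k (cmod (w x)) (cmod (w y)) (?d / k)"
      using dist_cone_pt_le_cone_dist[of \<phi> "cmod (w x)" "cmod (w y)" "\<alpha> + Arg (w x) / k" "\<alpha> + Arg (w y) / k"] k
      by (simp add: g_def k_def diff_divide_distrib)
    also have "\<dots> = cmod (of_real (cmod (w x)) * cis (Arg (w x)) - of_real (cmod (w y)) * cis (Arg (w y)))"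
      unfolding norm_polar_diff cone_dist_def kd by simp
    also have "\<dots> = cmod (w x - w y)"
      unfolding rcis_def[symmetric] rcis_cmod_Arg ..
    also have "w x - w y = of_real (y - x) * (of_real a * cis 0 - of_real b * cis \<omega>)"
      by (simp add: w_def algebra_simps)
    also have "cmod \<dots> = L * \<bar>x - y\<bar>"
      unfolding norm_mult L(2)[symmetric] norm_of_real by (simp add: abs_minus_commute)
    finally show ?thesis .
  qed
  \<comment> \<open>Continuity comes from the Lipschitz bound, so the continuity of
    \<open>Arg\<close> is never invoked.\<close>
  have "L-lipschitz_on {0..1} g"
    using lip by (intro lipschitz_onI) (auto simp: dist_real_def L_def)
  then have "path g" unfolding path_def by (rule lipschitz_on_continuous_on)
  moreover have "path_image g \<subseteq> cup_side \<phi>"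
  proof -
    have "g t \<in> cup_side \<phi>" if "t \<in> {0..1}" for t
    proof -
      have "cmod (w t) \<le> (1 - t) * a + t * b"
        using norm_triangle_ineq[of "complex_of_real ((1 - t) * a)" "of_real (t * b) * cis \<omega>"] that a b
        unfolding w_def norm_mult norm_of_real norm_cis by simp
      also have "\<dots> \<le> (1 - t) * cup_slant \<phi> + t * cup_slant \<phi>"
        using that a b by (intro add_mono mult_left_mono) auto
      finally have "cmod (w t) \<le> cup_slant \<phi>" by (simp add: algebra_simps)
      then show ?thesis unfolding cup_side_eq[OF \<phi>] g_def by auto
    qed
    then show ?thesis by (auto simp: path_image_def)
  qed
  moreover have "pathstart g = cone_pt \<phi> a \<alpha>"
    using a by (simp add: pathstart_def g_def w_def)
  moreover have "pathfinish g = cone_pt \<phi> b (\<alpha> + \<psi>)"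
  proof -
    have "w 1 = of_real b * exp (\<i> * of_real \<omega>)" by (simp add: w_def cis_conv_exp)
    then have "Arg (w 1) = \<omega>" using b \<omega> by (intro Arg_unique[of b \<omega>]) auto
    then show ?thesis using b k by (simp add: pathfinish_def g_def w_def norm_mult \<omega>_def)
  qed
  moreover have "curve_length g \<le> ennreal L"
  proof -
    have "dist (g x) (g y) \<le> L * (y - x)" if "0 \<le> x" "x \<le> y" "y \<le> 1" for x y
      using lip[of x y] that by simp
    then show ?thesis
      unfolding curve_length_eq_length_on
      using length_on_le_Lipschitz[of L 0 1 g] by (simp add: L_def)
  qed
  ultimately show ?thesis unfolding path_from_to_def L_def k_def by blast
qed

text \<open>The rolled segment attains the lower bound. The second fact fixes the length of every
  minimal path, as uniqueness may fail at \<psi> = pi.\<close>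

lemma minimal_path_cone:
  assumes \<phi>: "0 < \<phi>" "\<phi> < pi / 2" and a: "0 < a" "a \<le> cup_slant \<phi>"
    and b: "0 < b" "b \<le> cup_slant \<phi>" and \<psi>: "0 \<le> \<psi>" "\<psi> \<le> pi"
    and P: "P = cone_pt \<phi> a \<alpha>" and Q: "Q = cone_pt \<phi> b (\<alpha> + \<psi>)"
  shows "\<exists>g. minimal_path (cup_side \<phi>) P Q g"
    and "minimal_path (cup_side \<phi>) P Q g \<Longrightarrow>
      curve_length g = ennreal (cone_dist (sin \<phi>) a b \<psi>)"
proof -
  have ge: "ennreal (cone_dist (sin \<phi>) a b \<psi>) \<le> curve_length g"
    if "path_from_to (cup_side \<phi>) P Q g" for g
  proof -
    have "0 < sin \<phi>" using \<phi> by (intro sin_gt_zero) auto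
    moreover have "\<exists>\<rho> \<alpha>. 0 \<le> \<rho> \<and> g t = cone_pt \<phi> \<rho> \<alpha>" if "t \<in> {0..1}" for t
      using \<open>path_from_to (cup_side \<phi>) P Q g\<close> that
      unfolding path_from_to_def path_image_def cup_side_eq[OF \<phi>] by blast
    ultimately have "ennreal (cone_dist (sin \<phi>) a b (\<alpha> - (\<alpha> + \<psi>))) \<le> length_on g 0 1"
      using that a b P Q
      by (intro cone_dist_le_length_on)
        (auto simp: path_from_to_def path_def pathstart_def pathfinish_def)
    then show ?thesis by (simp add: curve_length_eq_length_on cone_dist_def)
  qed
  obtain g0 where g0: "path_from_to (cup_side \<phi>) P Q g0"
    "curve_length g0 \<le> ennreal (cone_dist (sin \<phi>) a b \<psi>)"
    using ex_cone_path[OF \<phi> a b \<psi>, of \<alpha>] P Q by auto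
  show "\<exists>g. minimal_path (cup_side \<phi>) P Q g"
    using g0 ge unfolding minimal_path_def by (meson order_trans)
  show "curve_length g = ennreal (cone_dist (sin \<phi>) a b \<psi>)"
    if "minimal_path (cup_side \<phi>) P Q g"
    using g0 ge that unfolding minimal_path_def by (meson order_trans antisym)
qed

section \<open>Paths that touch the lid\<close>

text \<open>Closedness extends a half-open stretch on the side to the contact point that ends it, as
  \<open>cup_path_cases\<close> requires.\<close>

lemma closed_cup_side:
  assumes \<phi>: "0 < \<phi>" "\<phi> < pi / 2"
  shows "closed (cup_side \<phi>)"
proof -
  have t: "0 < tan \<phi>" using \<phi> by (rule tan_gt_zero)
  have "cup_side \<phi> = {x. 0 \<le> x $ 3 \<and> x $ 3 \<le> cup_height \<phi> \<and>
      (x $ 1)\<^sup>2 + (x $ 2)\<^sup>2 = (x $ 3 * tan \<phi>)\<^sup>2}"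
  proof (intro equalityI subsetI)
    fix x assume "x \<in> cup_side \<phi>"
    then obtain \<alpha> z where x: "x = cyl (z * tan \<phi>) \<alpha> z" "0 \<le> z" "z \<le> cup_height \<phi>"
      by (auto simp: cup_side_def)
    have "(z * tan \<phi> * cos \<alpha>)\<^sup>2 + (z * tan \<phi> * sin \<alpha>)\<^sup>2 = (z * tan \<phi>)\<^sup>2 * ((cos \<alpha>)\<^sup>2 + (sin \<alpha>)\<^sup>2)"
      by algebra
    then show "x \<in> {x. 0 \<le> x $ 3 \<and> x $ 3 \<le> cup_height \<phi> \<and>
        (x $ 1)\<^sup>2 + (x $ 2)\<^sup>2 = (x $ 3 * tan \<phi>)\<^sup>2}"
      using x by simp
  next
    fix x :: "real ^ 3"
    assume "x \<in> {x. 0 \<le> x $ 3 \<and> x $ 3 \<le> cup_height \<phi> \<and>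
        (x $ 1)\<^sup>2 + (x $ 2)\<^sup>2 = (x $ 3 * tan \<phi>)\<^sup>2}"
    then have x: "0 \<le> x $ 3" "x $ 3 \<le> cup_height \<phi>" "(x $ 1)\<^sup>2 + (x $ 2)\<^sup>2 = (x $ 3 * tan \<phi>)\<^sup>2"
      by auto
    define w where "w = Complex (x $ 1) (x $ 2)"
    have "cmod w = x $ 3 * tan \<phi>" using x t by (simp add: w_def cmod_def)
    then have "Re w = x $ 3 * tan \<phi> * cos (Arg w)" "Im w = x $ 3 * tan \<phi> * sin (Arg w)"
      by (metis Re_rcis rcis_cmod_Arg) (metis Im_rcis rcis_cmod_Arg \<open>cmod w = x $ 3 * tan \<phi>\<close>)
    then have "x $ 1 = x $ 3 * tan \<phi> * cos (Arg w)" "x $ 2 = x $ 3 * tan \<phi> * sin (Arg w)"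
      by (simp_all only: w_def complex.sel)
    then have "x = cyl (x $ 3 * tan \<phi>) (Arg w) (x $ 3)"
      by (simp add: vec_eq_iff forall_3)
    then show "x \<in> cup_side \<phi>" unfolding cup_side_def using x by blast
  qed
  then show ?thesis
    by (auto intro!: closed_Collect_conj closed_Collect_le closed_Collect_eq continuous_intros)
qed

context
  fixes \<phi> :: real
  assumes \<phi>: "0 < \<phi>" "\<phi> < pi / 2"
begin

lemma sin_cos_pos: "0 < sin \<phi>" "sin \<phi> < 1" "0 < cos \<phi>"
  using \<phi> sin_monotone_2pi[of \<phi> "pi / 2"] by (auto intro: sin_gt_zero cos_gt_zero)

lemma slant_pos: "0 < cup_slant \<phi>"
  using sin_cos_pos by (simp add: cup_slant_def)

lemma rim_point_eq: "rim_point \<phi> t = cone_pt \<phi> (cup_slant \<phi>) t"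
  using sin_cos_pos by (simp add: rim_point_def cone_pt_def cup_slant_def cup_height_def cot_def)

lemma dist_rim_point: "dist (rim_point \<phi> x) (rim_point \<phi> y) = sqrt (2 - 2 * cos (x - y))"
proof -
  have "(dist (rim_point \<phi> x) (rim_point \<phi> y))\<^sup>2 = 2 - 2 * cos (x - y)"
    unfolding rim_point_def dist_cyl_sq by simp
  then show ?thesis by (metis real_sqrt_unique zero_le_dist)
qed

text \<open>By convexity of the unit disc; modulus and argument of the convex combination give the
  cylindrical coordinates that \<open>cup_lid\<close> asks for.\<close>

lemma linepath_rim_subset_lid: "path_image (linepath (rim_point \<phi> x) (rim_point \<phi> y)) \<subseteq> cup_lid \<phi>"
proof
  fix p assume "p \<in> path_image (linepath (rim_point \<phi> x) (rim_point \<phi> y))"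
  then obtain t where t: "0 \<le> t" "t \<le> 1"
    and p: "p = (1 - t) *\<^sub>R rim_point \<phi> x + t *\<^sub>R rim_point \<phi> y"
    by (auto simp: path_image_def linepath_def)
  define w where "w = of_real (1 - t) * cis x + of_real t * cis y"
  have "cmod w \<le> cmod (of_real (1 - t) * cis x) + cmod (of_real t * cis y)"
    unfolding w_def by (rule norm_triangle_ineq)
  also have "\<dots> = 1" unfolding norm_mult norm_of_real norm_cis using t by simp
  finally have "cmod w \<le> 1" .
  have "Re w = cmod w * cos (Arg w)" "Im w = cmod w * sin (Arg w)"
    by (metis Re_rcis rcis_cmod_Arg) (metis Im_rcis rcis_cmod_Arg)
  then have "p = cyl (cmod w) (Arg w) (cup_height \<phi>)"
    by (simp add: vec_eq_iff forall_3 p rim_point_def w_def algebra_simps)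
  then show "p \<in> cup_lid \<phi>" unfolding cup_lid_def using \<open>cmod w \<le> 1\<close> by auto
qed

lemma cup_height_side:
  assumes "x \<in> cup_side \<phi>" "x $ 3 = cup_height \<phi>"
  shows "\<exists>\<alpha>. x = rim_point \<phi> \<alpha>"
  using assms sin_cos_pos
  by (auto simp: cup_side_def rim_point_def cup_height_def cot_def tan_def)

text \<open>A path touching the lid runs on the side until its first and after its last contact with the
  plane of the lid.\<close>

lemma cup_path_cases:
  assumes g: "path_from_to (cup \<phi>) A B g" and AB: "A \<in> cup_side \<phi>" "B \<in> cup_side \<phi>"
  obtains "path_from_to (cup_side \<phi>) A B g"
  | x y \<alpha> \<beta> where "0 \<le> x" "x \<le> y" "y \<le> 1" "g x = rim_point \<phi> \<alpha>" "g y = rim_point \<phi> \<beta>"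
      "g ` {0..x} \<subseteq> cup_side \<phi>" "g ` {y..1} \<subseteq> cup_side \<phi>"
proof -
  \<comment> \<open>Contact is measured by height: the whole lid has this height, so off K the path
    is on the side, and a point of the side at this height is on the rim.\<close>
  define K where "K = {t \<in> {0..1}. g t $ 3 = cup_height \<phi>}"
  have cont: "continuous_on {0..1} g" and img: "\<And>t. t \<in> {0..1} \<Longrightarrow> g t \<in> cup \<phi>"
    and ends: "g 0 = A" "g 1 = B"
    using g by (auto simp: path_from_to_def path_def path_image_def pathstart_def pathfinish_def)
  have side: "g t \<in> cup_side \<phi>" if "t \<in> {0..1}" "t \<notin> K" for t
    using img[OF that(1)] that by (auto simp: cup_def cup_lid_def K_def)
  show thesis
  proof (cases "K = {}")
    case True
    then have "path_from_to (cup_side \<phi>) A B g"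
      using g side by (auto simp: path_from_to_def path_image_def)
    then show thesis by (rule that(1))
  next
    case False
    have "continuous_on {0..1} (\<lambda>t. g t $ 3)" using cont by (intro continuous_intros)
    then have "closed ({0..1} \<inter> (\<lambda>t. g t $ 3) -` {cup_height \<phi>})"
      by (intro continuous_closed_preimage) auto
    moreover have "{0..1} \<inter> (\<lambda>t. g t $ 3) -` {cup_height \<phi>} = K" by (auto simp: K_def)
    ultimately have "closed K" by (rule back_subst)
    moreover have "bounded K" by (rule bounded_subset[of "{0..1}"]) (auto simp: K_def)
    ultimately have "compact K" by (simp add: compact_eq_bounded_closed)
    then obtain x y where x: "x \<in> K" "\<And>t. t \<in> K \<Longrightarrow> x \<le> t" and y: "y \<in> K" "\<And>t. t \<in> K \<Longrightarrow> t \<le> y"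
      using compact_attains_inf[of K] compact_attains_sup[of K] False by metis
    have xy: "0 \<le> x" "x \<le> y" "y \<le> 1" "x \<le> 1" "0 \<le> y" using x y by (auto simp: K_def)
    have closed_pre: "closed ({0..1} \<inter> g -` cup_side \<phi>)"
      using cont closed_cup_side[OF \<phi>] by (intro continuous_closed_preimage) auto
    have left: "{0..x} \<subseteq> {0..1} \<inter> g -` cup_side \<phi>"
    \<comment> \<open>For x = 0 the half-open interval is empty and its closure gives nothing; then
      the point is \<open>A\<close>, which lies on the side.\<close>
    proof (cases "x = 0")
      case True
      then show ?thesis using ends AB by simp
    next
      case False
      then have "closure {0..<x} = {0..x}" using xy by simp
      moreover have "closure {0..<x} \<subseteq> {0..1} \<inter> g -` cup_side \<phi>"
        using closed_pre
      proof (intro closure_minimal subsetI)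
        fix t assume "t \<in> {0..<x}"
        then show "t \<in> {0..1} \<inter> g -` cup_side \<phi>" using side[of t] x(2)[of t] xy by force
      qed
      ultimately show ?thesis by simp
    qed
    have right: "{y..1} \<subseteq> {0..1} \<inter> g -` cup_side \<phi>"
    proof (cases "y = 1")
      case True
      then show ?thesis using ends AB by simp
    next
      case False
      then have "closure {y<..1} = {y..1}" using xy by simp
      moreover have "closure {y<..1} \<subseteq> {0..1} \<inter> g -` cup_side \<phi>"
        using closed_pre
      proof (intro closure_minimal subsetI)
        fix t assume "t \<in> {y<..1}"
        then show "t \<in> {0..1} \<inter> g -` cup_side \<phi>" using side[of t] y(2)[of t] xy by force
      qed
      ultimately show ?thesis by simp
    qed
    have "g x \<in> cup_side \<phi>" "g y \<in> cup_side \<phi>" using left right xy by auto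
    moreover have "g x $ 3 = cup_height \<phi>" "g y $ 3 = cup_height \<phi>"
      using x(1) y(1) by (auto simp: K_def)
    ultimately obtain \<alpha> \<beta> where "g x = rim_point \<phi> \<alpha>" "g y = rim_point \<phi> \<beta>"
      using cup_height_side by blast
    then show thesis using left right xy by (intro that(2)[of x y \<alpha> \<beta>]) auto
  qed
qed

text \<open>Dividing by the slant height is multiplying by \<open>sin \<phi>\<close>, and angles in
  [0, pi] are fixed by \<open>circ_dist\<close>; so the first two roots are cone distances to the
  rim.\<close>

lemma crossing_length_eq:
  assumes "0 \<le> t" "t \<le> pi" "0 \<le> u" "u \<le> pi"
  shows "crossing_length (cup_slant \<phi>) a b \<theta> t u =
    cone_dist (sin \<phi>) a (cup_slant \<phi>) t + cone_dist (sin \<phi>) (cup_slant \<phi>) b u +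
    dist (rim_point \<phi> t) (rim_point \<phi> (\<theta> - u))"
proof -
  have "cos (t - (\<theta> - u)) = cos (\<theta> - t - u)" using cos_minus[of "\<theta> - t - u"] by (simp add: algebra_simps)
  moreover have "t / cup_slant \<phi> = sin \<phi> * t" "u / cup_slant \<phi> = sin \<phi> * u"
    by (simp_all add: cup_slant_def)
  ultimately show ?thesis
    unfolding crossing_length_def cone_dist_def dist_rim_point using assms
    by (simp add: arccos_cos algebra_simps)
qed

text \<open>Reflecting in the plane through \<open>A\<close> and the axis moves both rim points into the half circle
  \<open>[0, \<pi>]\<close>; there, cutting off angles at \<open>\<theta>\<close> contracts all three distances.\<close>

lemma ex_crossing_length_le:
  assumes \<theta>: "0 \<le> \<theta>" "\<theta> \<le> pi" and ab: "0 \<le> a" "0 \<le> b"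
  shows "\<exists>t\<in>{0..\<theta>}. \<exists>u\<in>{0..\<theta>}. crossing_length (cup_slant \<phi>) a b \<theta> t u \<le>
    cone_dist (sin \<phi>) a (cup_slant \<phi>) \<alpha> + cone_dist (sin \<phi>) (cup_slant \<phi>) b (\<beta> - \<theta>) +
    dist (rim_point \<phi> \<alpha>) (rim_point \<phi> \<beta>)"
proof -
  define x y where "x = circ_dist \<alpha>" and "y = circ_dist \<beta>"
  have xy: "0 \<le> x" "x \<le> pi" "0 \<le> y" "y \<le> pi" using circ_dist_bounds by (auto simp: x_def y_def)
  \<comment> \<open>Since u is measured backwards from \<open>\<theta>\<close>, the second rim point
    \<open>\<theta> - u\<close> is the folded angle y cut off at \<open>\<theta>\<close>.\<close>
  define t u where "t = min x \<theta>" and "u = \<theta> - min y \<theta>"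
  have tu: "0 \<le> t" "t \<le> \<theta>" "0 \<le> u" "u \<le> \<theta>" using xy \<theta> by (auto simp: t_def u_def)
  have cos_le: "cos p \<le> cos q" if "\<bar>q\<bar> \<le> \<bar>p\<bar>" "\<bar>p\<bar> \<le> pi" for p q :: real
    using cos_monotone_0_pi_le[of "\<bar>q\<bar>" "\<bar>p\<bar>"] that by simp
  have "cos \<alpha> = cos x" by (simp add: x_def)
  also have "\<dots> \<le> cos t" using xy tu by (intro cos_le) (auto simp: t_def)
  finally have 1: "cos \<alpha> \<le> cos t" .
  have "cos (\<beta> - \<theta>) \<le> cos (y - circ_dist \<theta>)" unfolding y_def by (rule cos_diff_circ_dist)
  \<comment> \<open>\<open>\<theta>\<close> already lies in [0, pi], so folding leaves
    \<open>B\<close> in place.\<close>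
  also have "\<dots> = cos (y - \<theta>)" using \<theta> by (simp add: arccos_cos)
  also have "\<dots> \<le> cos u" using xy \<theta> by (intro cos_le) (auto simp: u_def)
  finally have 2: "cos (\<beta> - \<theta>) \<le> cos u" .
  have "cos (\<alpha> - \<beta>) \<le> cos (x - y)" unfolding x_def y_def by (rule cos_diff_circ_dist)
  also have "\<dots> \<le> cos (t - (\<theta> - u))" using xy \<theta> by (intro cos_le) (auto simp: t_def u_def)
  finally have 3: "cos (\<alpha> - \<beta>) \<le> cos (t - (\<theta> - u))" .
  have "crossing_length (cup_slant \<phi>) a b \<theta> t u =
      cone_dist (sin \<phi>) a (cup_slant \<phi>) t + cone_dist (sin \<phi>) (cup_slant \<phi>) b u +
      dist (rim_point \<phi> t) (rim_point \<phi> (\<theta> - u))"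
    using tu \<theta> by (intro crossing_length_eq) auto
  also have "\<dots> \<le> cone_dist (sin \<phi>) a (cup_slant \<phi>) \<alpha> + cone_dist (sin \<phi>) (cup_slant \<phi>) b (\<beta> - \<theta>) +
      dist (rim_point \<phi> \<alpha>) (rim_point \<phi> \<beta>)"
    unfolding dist_rim_point using 1 2 3 sin_cos_pos slant_pos ab
    by (intro add_mono cone_dist_mono real_sqrt_le_mono) auto
  finally show ?thesis using tu by (intro bexI[of _ t] bexI[of _ u]) auto
qed

end

section \<open>The two candidates compared with an arbitrary path on the cup\<close>

theorem proposition5:
  fixes \<phi> \<theta> s a b :: real and A B :: "real ^ 3"
  assumes "0 < \<phi>" and "\<phi> < pi / 2"
    and "s = cup_slant \<phi>"
    and "A \<in> cup_side \<phi>" and "B \<in> cup_side \<phi>"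
    and "\<not> axial A" and "\<not> axial B" and "A \<noteq> B"
    and "0 \<le> \<theta>" and "\<theta> \<le> pi"
    and "has_cyl_angle A 0" and "has_cyl_angle B \<theta>"
    and "a = dist A 0" and "b = dist B 0"
  shows "(\<forall>t\<in>{0..\<theta>}. \<forall>u\<in>{0..\<theta>}.
            (\<exists>\<beta>. lid_crossing \<phi> \<theta> A B t u \<beta>) \<and>
            (\<forall>\<beta>. lid_crossing \<phi> \<theta> A B t u \<beta> \<longrightarrow>
                   curve_length \<beta> = ennreal (crossing_length s a b \<theta> t u))) \<and>
         (\<exists>\<alpha>. minimal_path (cup_side \<phi>) A B \<alpha>) \<and>
         (\<exists>t1\<in>{0..\<theta>}. \<exists>u1\<in>{0..\<theta>}. \<forall>t\<in>{0..\<theta>}. \<forall>u\<in>{0..\<theta>}.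
            crossing_length s a b \<theta> t1 u1 \<le> crossing_length s a b \<theta> t u) \<and>
         (\<forall>\<alpha> \<beta> \<gamma>. \<forall>t1\<in>{0..\<theta>}. \<forall>u1\<in>{0..\<theta>}.
            minimal_path (cup_side \<phi>) A B \<alpha> \<longrightarrow>
            lid_crossing \<phi> \<theta> A B t1 u1 \<beta> \<longrightarrow>
            (\<forall>t\<in>{0..\<theta>}. \<forall>u\<in>{0..\<theta>}.
               crossing_length s a b \<theta> t1 u1 \<le> crossing_length s a b \<theta> t u) \<longrightarrow>
            \<gamma> \<in> {\<alpha>, \<beta>} \<longrightarrow>
            (\<forall>\<delta>\<in>{\<alpha>, \<beta>}. curve_length \<gamma> \<le> curve_length \<delta>) \<longrightarrow>
            minimal_path (cup \<phi>) A B \<gamma>)"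
proof -
  note \<phi> = \<open>0 < \<phi>\<close> \<open>\<phi> < pi / 2\<close>
  note \<theta> = \<open>0 \<le> \<theta>\<close> \<open>\<theta> \<le> pi\<close>
  have s: "0 < s" "s = cup_slant \<phi>" using slant_pos[OF \<phi>] assms(3) by auto
  have k: "0 < sin \<phi>" "sin \<phi> < 1" using sin_cos_pos[OF \<phi>] by auto
  \<comment> \<open>Membership in the side supplies some angle, not necessarily x. Matching radius
    and height shows that the same slant distance works with the prescribed angle; nonnegativity of
    r rules out the opposite half-plane.\<close>
  have position: "P = cone_pt \<phi> (dist P 0) x \<and> 0 < dist P 0 \<and> dist P 0 \<le> s"
    if P: "P \<in> cup_side \<phi>" "\<not> axial P" "has_cyl_angle P x" for P x
  proof -
    obtain \<rho> \<alpha> where \<rho>: "P = cone_pt \<phi> \<rho> \<alpha>" "0 \<le> \<rho>" "\<rho> \<le> s"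
      using P(1) unfolding cup_side_eq[OF \<phi>] s(2) by auto
    obtain r z where r: "P = cyl r x z" "0 \<le> r" using P(3) by (auto simp: has_cyl_angle_def)
    have "(P $ 1)\<^sup>2 + (P $ 2)\<^sup>2 = r\<^sup>2 * ((cos x)\<^sup>2 + (sin x)\<^sup>2)"
      unfolding r cyl_nth by algebra
    moreover have "(P $ 1)\<^sup>2 + (P $ 2)\<^sup>2 = (\<rho> * sin \<phi>)\<^sup>2 * ((cos \<alpha>)\<^sup>2 + (sin \<alpha>)\<^sup>2)"
      unfolding \<rho> cone_pt_def cyl_nth by algebra
    ultimately have "r\<^sup>2 = (\<rho> * sin \<phi>)\<^sup>2" by simp
    then have "r = \<rho> * sin \<phi>" using r \<rho> k by (simp add: power2_eq_iff_nonneg)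
    moreover have "z = \<rho> * cos \<phi>" using arg_cong[OF r(1), of "\<lambda>p. p $ 3"] \<rho>(1) by (simp add: cone_pt_def)
    ultimately have "P = cone_pt \<phi> \<rho> x" using r by (simp add: cone_pt_def)
    moreover have "\<rho> \<noteq> 0" using P(2) \<rho>(1) by (auto simp: axial_def cone_pt_def)
    ultimately show ?thesis using \<rho> by (simp add: norm_cone_pt)
  qed
  have A: "A = cone_pt \<phi> a 0" "0 < a" "a \<le> s" and B: "B = cone_pt \<phi> b \<theta>" "0 < b" "b \<le> s"
    using position[of A 0] position[of B \<theta>] assms by auto
  have rim: "rim_point \<phi> t = cone_pt \<phi> s t" for t using rim_point_eq[OF \<phi>] s by simp
  have seg1: "\<exists>g. minimal_path (cup_side \<phi>) A (rim_point \<phi> t) g"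
      "minimal_path (cup_side \<phi>) A (rim_point \<phi> t) g \<Longrightarrow> curve_length g = ennreal (cone_dist (sin \<phi>) a s t)"
    if "t \<in> {0..\<theta>}" for t g
    using minimal_path_cone[OF \<phi> A(2) _ s(1), of t A 0 "rim_point \<phi> t"] that A(1,3) rim s(2) \<theta> by auto
  have seg2: "\<exists>g. minimal_path (cup_side \<phi>) (rim_point \<phi> (\<theta> - u)) B g"
      "minimal_path (cup_side \<phi>) (rim_point \<phi> (\<theta> - u)) B g \<Longrightarrow>
        curve_length g = ennreal (cone_dist (sin \<phi>) s b u)"
    if "u \<in> {0..\<theta>}" for u g
    using minimal_path_cone[OF \<phi> s(1) _ B(2), of u "rim_point \<phi> (\<theta> - u)" "\<theta> - u" B] that B(1,3) rim s(2) \<theta>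
    by auto
  have side_min: "\<exists>g. minimal_path (cup_side \<phi>) A B g"
    using minimal_path_cone(1)[OF \<phi> A(2) _ B(2), of \<theta> A 0 B] A B s(2) \<theta> by auto
  have crossing: "crossing_length s a b \<theta> t u = cone_dist (sin \<phi>) a s t + cone_dist (sin \<phi>) s b u +
      dist (rim_point \<phi> t) (rim_point \<phi> (\<theta> - u))" if "t \<in> {0..\<theta>}" "u \<in> {0..\<theta>}" for t u
    using crossing_length_eq[OF \<phi>, of t u a b \<theta>] that \<theta> s by auto
  have lid_length: "curve_length \<beta> = ennreal (crossing_length s a b \<theta> t u)"
    and lid_path: "path_from_to (cup \<phi>) A B \<beta>"
    if tu: "t \<in> {0..\<theta>}" "u \<in> {0..\<theta>}" and \<beta>: "lid_crossing \<phi> \<theta> A B t u \<beta>" for t u \<beta>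
  proof -
    let ?l = "linepath (rim_point \<phi> t) (rim_point \<phi> (\<theta> - u))"
    obtain \<gamma>1 \<gamma>2 where \<gamma>: "minimal_path (cup_side \<phi>) A (rim_point \<phi> t) \<gamma>1"
      "minimal_path (cup_side \<phi>) (rim_point \<phi> (\<theta> - u)) B \<gamma>2" "\<beta> = \<gamma>1 +++ ?l +++ \<gamma>2"
      using \<beta> unfolding lid_crossing_def by blast
    note pf = \<gamma>(1,2)[unfolded minimal_path_def path_from_to_def]
    have "curve_length \<beta> = curve_length \<gamma>1 + (curve_length ?l + curve_length \<gamma>2)"
      unfolding \<gamma>(3) using pf by (simp add: curve_length_joinpaths)
    then show "curve_length \<beta> = ennreal (crossing_length s a b \<theta> t u)"
      unfolding seg1(2)[OF tu(1) \<gamma>(1)] seg2(2)[OF tu(2) \<gamma>(2)] curve_length_linepath crossing[OF tu]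
      by (simp add: algebra_simps flip: ennreal_plus)
    have "path_image \<beta> \<subseteq> path_image \<gamma>1 \<union> (path_image ?l \<union> path_image \<gamma>2)"
      unfolding \<gamma>(3) using path_image_join_subset by blast
    then show "path_from_to (cup \<phi>) A B \<beta>"
      using pf linepath_rim_subset_lid[OF \<phi>, of t "\<theta> - u"]
      unfolding path_from_to_def \<gamma>(3) cup_def by auto
  qed
  have lid_ex: "\<exists>\<beta>. lid_crossing \<phi> \<theta> A B t u \<beta>" if "t \<in> {0..\<theta>}" "u \<in> {0..\<theta>}" for t u
    unfolding lid_crossing_def using seg1(1)[OF that(1)] seg2(1)[OF that(2)] by blast
  have min_ex: "\<exists>t1\<in>{0..\<theta>}. \<exists>u1\<in>{0..\<theta>}. \<forall>t\<in>{0..\<theta>}. \<forall>u\<in>{0..\<theta>}.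
      crossing_length s a b \<theta> t1 u1 \<le> crossing_length s a b \<theta> t u"
  proof -
    have "continuous_on ({0..\<theta>} \<times> {0..\<theta>}) (\<lambda>p. crossing_length s a b \<theta> (fst p) (snd p))"
      unfolding crossing_length_def using s(1) by (intro continuous_intros) auto
    moreover have "compact ({0..\<theta>} \<times> {0..\<theta>})" "{0..\<theta>} \<times> {0..\<theta>} \<noteq> {}"
      using \<theta> by (auto intro: compact_Times)
    ultimately obtain p where "p \<in> {0..\<theta>} \<times> {0..\<theta>}"
      "\<forall>q\<in>{0..\<theta>} \<times> {0..\<theta>}. crossing_length s a b \<theta> (fst p) (snd p) \<le> crossing_length s a b \<theta> (fst q) (snd q)"
      using continuous_attains_inf by blast
    then show ?thesis by (intro bexI[of _ "fst p"] bexI[of _ "snd p"]) auto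
  qed
  have min_cup: "minimal_path (cup \<phi>) A B \<gamma>"
    if tu: "t1 \<in> {0..\<theta>}" "u1 \<in> {0..\<theta>}" and \<alpha>: "minimal_path (cup_side \<phi>) A B \<alpha>"
      and \<beta>: "lid_crossing \<phi> \<theta> A B t1 u1 \<beta>"
      and min: "\<And>t u. t \<in> {0..\<theta>} \<Longrightarrow> u \<in> {0..\<theta>} \<Longrightarrow>
        crossing_length s a b \<theta> t1 u1 \<le> crossing_length s a b \<theta> t u"
      and \<gamma>: "\<gamma> \<in> {\<alpha>, \<beta>}" "\<And>\<delta>. \<delta> \<in> {\<alpha>, \<beta>} \<Longrightarrow> curve_length \<gamma> \<le> curve_length \<delta>"
    for \<alpha> \<beta> \<gamma> t1 u1
    unfolding minimal_path_def
  proof (intro conjI allI impI)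
    show "path_from_to (cup \<phi>) A B \<gamma>"
      using \<gamma>(1) lid_path[OF tu \<beta>] \<alpha> by (auto simp: minimal_path_def path_from_to_def cup_def)
    fix g assume g: "path_from_to (cup \<phi>) A B g"
    then show "curve_length \<gamma> \<le> curve_length g"
    proof (cases rule: cup_path_cases[OF \<phi> g assms(4,5)])
      case 1
      then have "curve_length \<alpha> \<le> curve_length g" using \<alpha> by (simp add: minimal_path_def)
      then show ?thesis using \<gamma>(2)[of \<alpha>] by simp
    next
      case (2 x y \<xi> \<eta>)
      have cont: "continuous_on {0..1} g" and ends: "g 0 = A" "g 1 = B"
        using g by (auto simp: path_from_to_def path_def pathstart_def pathfinish_def)
      have on_cone: "\<exists>\<rho> \<alpha>. 0 \<le> \<rho> \<and> g t = cone_pt \<phi> \<rho> \<alpha>" if "t \<in> {0..x} \<union> {y..1}" for t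
      proof -
        have "g t \<in> cup_side \<phi>" using 2(6,7) that by blast
        then show ?thesis unfolding cup_side_eq[OF \<phi>] by blast
      qed
      have rims: "g x = cone_pt \<phi> s \<xi>" "g y = cone_pt \<phi> s \<eta>" using 2(4,5) rim by simp_all
      have starts: "g 0 = cone_pt \<phi> a 0" "g 1 = cone_pt \<phi> b \<theta>" using ends A(1) B(1) by simp_all
      have "ennreal (cone_dist (sin \<phi>) a s (0 - \<xi>)) \<le> length_on g 0 x"
        using 2(1-3) A(2) s(1) on_cone
        by (intro cone_dist_le_length_on[OF k(1) _ _ _ starts(1) rims(1)] continuous_on_subset[OF cont]) auto
      moreover have "ennreal (cone_dist (sin \<phi>) s b (\<eta> - \<theta>)) \<le> length_on g y 1"
        using 2(1-3) B(2) s(1) on_cone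
        by (intro cone_dist_le_length_on[OF k(1) _ _ _ rims(2) starts(2)] continuous_on_subset[OF cont]) auto
      \<comment> \<open>Between the contacts the path may return to the side; the chord is a lower
        bound in any case, and it is exactly the lid segment of a crossing.\<close>
      moreover have "ennreal (dist (rim_point \<phi> \<xi>) (rim_point \<phi> \<eta>)) \<le> length_on g x y"
        using dist_le_length_on[OF 2(2), of g] unfolding 2(4,5) .
      moreover have "cone_dist (sin \<phi>) a s (0 - \<xi>) = cone_dist (sin \<phi>) a s \<xi>"
        by (simp add: cone_dist_def)
      moreover have "curve_length g = length_on g 0 x + length_on g x y + length_on g y 1"
        unfolding curve_length_eq_length_on
        using length_on_split[of 0 x 1 g] length_on_split[of x y 1 g] 2(1-3) by (simp add: add.assoc)
      ultimately have "ennreal (cone_dist (sin \<phi>) a s \<xi>) + ennreal (dist (rim_point \<phi> \<xi>) (rim_point \<phi> \<eta>)) +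
          ennreal (cone_dist (sin \<phi>) s b (\<eta> - \<theta>)) \<le> curve_length g"
        by (simp add: add_mono)
      then have ge: "ennreal (cone_dist (sin \<phi>) a s \<xi> + cone_dist (sin \<phi>) s b (\<eta> - \<theta>) +
          dist (rim_point \<phi> \<xi>) (rim_point \<phi> \<eta>)) \<le> curve_length g"
        by (simp add: algebra_simps flip: ennreal_plus)
      obtain t u where "t \<in> {0..\<theta>}" "u \<in> {0..\<theta>}" "crossing_length s a b \<theta> t u \<le>
          cone_dist (sin \<phi>) a s \<xi> + cone_dist (sin \<phi>) s b (\<eta> - \<theta>) + dist (rim_point \<phi> \<xi>) (rim_point \<phi> \<eta>)"
        using ex_crossing_length_le[OF \<phi> \<theta>, of a b \<xi> \<eta>] A(2) B(2) s by auto
      \<comment> \<open>Only lengths are compared: minimality of \<open>(t1, u1)\<close> bounds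
        \<beta> by the folded crossing, and folding bounds that by the pieces of g.\<close>
      then have "curve_length \<beta> \<le> ennreal (cone_dist (sin \<phi>) a s \<xi> + cone_dist (sin \<phi>) s b (\<eta> - \<theta>) +
          dist (rim_point \<phi> \<xi>) (rim_point \<phi> \<eta>))"
        unfolding lid_length[OF tu \<beta>] using min[of t u] by (intro ennreal_leI) auto
      then show ?thesis using \<gamma>(2)[of \<beta>] ge by (meson insertI1 insertI2 order_trans)
    qed
  qed
  show ?thesis
    using lid_ex lid_length side_min min_ex min_cup by blast
qed

end
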